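(* Let $w(x_1,x_2)=x_1^{4/3}-x_2^{4/3}$ on $\mathbb R^2$. For $\alpha>0$ set $p_\alpha:=3$ if $\alpha\ge 1$ and $p_\alpha:=\frac{6}{3-\alpha}$ if $\alpha\in(0,1)$. Then for each $\alpha>0$, $$|Dw|^\alpha\in W^{1,p}_{\mathrm{loc}}(\mathbb R^2)\ \text{ for all } p<p_\alpha,\qquad\text{but}\qquad |Dw|^\alpha\notin W^{1,p_\alpha}_{\mathrm{loc}}(\mathbb R^2).$$ Moreover, $$\log|Dw|\in W^{1,p}_{\mathrm{loc}}(\mathbb R^2)\cap BMO_{\mathrm{loc}}(\mathbb R^2)\ \text{ for all } p<2,\qquad\text{but}\qquad \log|Dw|\notin W^{1,2}_{\mathrm{loc}}(\mathbb R^2).$$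
   Context: For real $t$, fractional powers such as $t^{4/3}$ and $t^{2/3}$ are understood as $|t|^{4/3}$ and $|t|^{2/3}$. $Dw$ is the gradient of $w$ and $|Dw|$ its Euclidean norm. The exponents $p$ are taken with $p\ge1$. *)

theory Defs
  imports "HOL-Analysis.Analysis"
begin

definition grad :: "('a::euclidean_space \<Rightarrow> real) \<Rightarrow> 'a \<Rightarrow> 'a" where
  "grad f x = (THE D. GDERIV f x :> D)"

definition partial_deriv :: "'a::euclidean_space \<Rightarrow> ('a \<Rightarrow> real) \<Rightarrow> 'a \<Rightarrow> real" where
  "partial_deriv i f x = frechet_derivative f (at x) i"

text \<open>For \<open>k > 0\<close>: differentiable everywhere with all first partial derivatives of class
  \<open>C\<close> to the power \<open>k - 1\<close>.\<close>

primrec C_k :: "nat \<Rightarrow> ('a::euclidean_space \<Rightarrow> real) \<Rightarrow> bool" where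
  "C_k 0 f \<longleftrightarrow> continuous_on UNIV f"
| "C_k (Suc k) f \<longleftrightarrow>
    (\<forall>x. f differentiable (at x)) \<and> (\<forall>i\<in>Basis. C_k k (partial_deriv i f))"

text \<open>Smooth functions with compact support in \<open>\<Omega>\<close>, regarded as functions on the whole space
  (extended by zero outside \<open>\<Omega>\<close>).\<close>

definition test_functions :: "'a::euclidean_space set \<Rightarrow> ('a \<Rightarrow> real) set" where
  "test_functions \<Omega> = {\<phi>. (\<forall>k. C_k k \<phi>) \<and> compact (closure {x. \<phi> x \<noteq> 0})
     \<and> closure {x. \<phi> x \<noteq> 0} \<subseteq> \<Omega>}"

definition locally_integrable :: "'a::euclidean_space set \<Rightarrow> ('a \<Rightarrow> real) \<Rightarrow> bool" where
  "locally_integrable \<Omega> f \<longleftrightarrow> (\<forall>K. compact K \<and> K \<subseteq> \<Omega> \<longrightarrow> integrable (lebesgue_on K) f)"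

text \<open>Functions on \<open>\<Omega>\<close> are represented by functions on the whole space, whose values outside
  \<open>\<Omega>\<close> are irrelevant; membership in the function spaces below does not depend on the
  values on a null set. The spaces are meant for \<open>\<Omega>\<close> open and finite exponents \<open>p \<ge> 1\<close>.
  Measurability of \<open>f\<close> is required separately, since integrability of \<open>\<bar>f\<bar> powr p\<close> does
  not imply it.\<close>

definition Lp_space :: "real \<Rightarrow> 'a::euclidean_space set \<Rightarrow> ('a \<Rightarrow> real) set" where
  "Lp_space p \<Omega> = {f. f \<in> borel_measurable (lebesgue_on \<Omega>)
     \<and> integrable (lebesgue_on \<Omega>) (\<lambda>x. \<bar>f x\<bar> powr p)}"

text \<open>\<open>g\<close> is a weak partial derivative of \<open>f\<close> in direction \<open>i\<close> on \<open>\<Omega>\<close>. Local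
  integrability guarantees that both integrals are genuine.\<close>

definition weak_partial_deriv ::
    "'a::euclidean_space set \<Rightarrow> 'a \<Rightarrow> ('a \<Rightarrow> real) \<Rightarrow> ('a \<Rightarrow> real) \<Rightarrow> bool" where
  "weak_partial_deriv \<Omega> i f g \<longleftrightarrow> locally_integrable \<Omega> f \<and> locally_integrable \<Omega> g \<and>
     (\<forall>\<phi>\<in>test_functions \<Omega>.
        (\<integral>x. f x * partial_deriv i \<phi> x \<partial>lebesgue_on \<Omega>) = - (\<integral>x. g x * \<phi> x \<partial>lebesgue_on \<Omega>))"

definition W1p :: "real \<Rightarrow> 'a::euclidean_space set \<Rightarrow> ('a \<Rightarrow> real) set" where
  "W1p p \<Omega> = {f \<in> Lp_space p \<Omega>. \<forall>i\<in>Basis. \<exists>g\<in>Lp_space p \<Omega>. weak_partial_deriv \<Omega> i f g}"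

definition compactly_contained :: "'a::euclidean_space set \<Rightarrow> 'a set \<Rightarrow> bool" where
  "compactly_contained U \<Omega> \<longleftrightarrow> compact (closure U) \<and> closure U \<subseteq> \<Omega>"

definition W1p_loc :: "real \<Rightarrow> 'a::euclidean_space set \<Rightarrow> ('a \<Rightarrow> real) set" where
  "W1p_loc p \<Omega> = {f. \<forall>U. open U \<and> compactly_contained U \<Omega> \<longrightarrow> f \<in> W1p p U}"

definition ball_average :: "('a::euclidean_space \<Rightarrow> real) \<Rightarrow> 'a \<Rightarrow> real \<Rightarrow> real" where
  "ball_average f x r = (\<integral>y. f y \<partial>lebesgue_on (cball x r)) / measure lebesgue (cball x r)"

text \<open>Only balls with closure in \<open>\<Omega>\<close> are tested, so that the averages of a locally integrable
  function exist.\<close>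

definition BMO :: "'a::euclidean_space set \<Rightarrow> ('a \<Rightarrow> real) set" where
  "BMO \<Omega> = {f. locally_integrable \<Omega> f \<and>
     (\<exists>C. \<forall>x r. 0 < r \<and> cball x r \<subseteq> \<Omega> \<longrightarrow>
        ball_average (\<lambda>y. \<bar>f y - ball_average f x r\<bar>) x r \<le> C)}"

definition BMO_loc :: "'a::euclidean_space set \<Rightarrow> ('a \<Rightarrow> real) set" where
  "BMO_loc \<Omega> = {f. \<forall>U. open U \<and> compactly_contained U \<Omega> \<longrightarrow> f \<in> BMO U}"

definition p_crit :: "real \<Rightarrow> real" where
  "p_crit \<alpha> = (if \<alpha> \<ge> 1 then 3 else 6 / (3 - \<alpha>))"

definition w :: "real ^ 2 \<Rightarrow> real" where
  "w x = \<bar>x $ 1\<bar> powr (4/3) - \<bar>x $ 2\<bar> powr (4/3)"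

end

theory Submission
  imports Defs
begin

text \<open>
  With \<open>rad x = \<bar>x $ 1\<bar> powr (2/3) + \<bar>x $ 2\<bar> powr (2/3)\<close> the
  gradient of \<open>w\<close> has norm \<open>4/3 * sqrt (rad x)\<close>
  (\<open>norm_grad_w\<close>). Its powers and its logarithm thus have the form \<open>G (rad
  x)\<close> with \<open>G' s = 3/2 * C * s powr (\<alpha> / 2 - 1)\<close>, where \<open>\<alpha> =
  0\<close> stands for the logarithm, and their partial derivative in direction \<open>i\<close>
  should be \<open>C * rad x powr (\<alpha> / 2 - 1) * sgn (x $ i) * \<bar>x $ i\<bar> powr (-
  (1/3))\<close>. This function is singular along the axis \<open>x $ i = 0\<close>, and away from
  the origin its \<open>p\<close>-th power is locally integrable exactly for \<open>p < 3\<close>.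
  It is moreover homogeneous of degree \<open>\<alpha> / 3 - 1\<close>, which restricts
  \<open>p\<close> at the origin to \<open>p * (3 - \<alpha>) < 6\<close>. For \<open>\<alpha> >
  0\<close> the two conditions together say \<open>p < p_crit \<alpha>\<close>; for the logarithm
  they say \<open>p < 2\<close>.

  Below the critical exponent, the derivative is dominated by a product of powers of the two
  coordinates, both \<open>p\<close>-integrable in dimension one
  (\<open>radial_deriv_dominated\<close>). It is the weak derivative because \<open>G (rad
  x)\<close> is continuous, and differentiable off one point, on almost every line parallel to an
  axis (\<open>integral_by_parts_slices\<close>).

  At the critical exponent, let \<open>h\<close> be any weak derivative. Testing with a bump on a
  box on which the classical derivative is at least \<open>m\<close> shows that \<open>\<bar>h\<bar>
  powr p\<close> has an integral over the box of at least a multiple, depending only on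
  \<open>p\<close>, of \<open>m powr p\<close> times its area
  (\<open>weak_derivative_Lp_lower_bound\<close>). For suitable boxes shrinking to the origin or
  collapsing onto an axis this quantity stays bounded below, whereas the integrals would have to
  tend to zero if \<open>\<bar>h\<bar> powr p\<close> were integrable
  (\<open>not_W1p_loc_if_blowup\<close>).

  For \<open>BMO\<close>, balls that are small compared with their distance from the origin see a
  bounded oscillation of \<open>ln (rad x)\<close>; every other ball lies in a square about the
  origin of comparable size \<open>r\<close>, on which \<open>ln (rad x / r powr (2/3))\<close> is
  dominated by a locally integrable function of \<open>x / r\<close>
  (\<open>log_profile_mean_oscillation\<close>).
\<close>

section \<open>The plane as a product of two lines\<close>

text \<open>Slicing is done parallel to either axis, so the distinguished coordinate
  \<open>i\<close> is a parameter: the first component of the pair becomes coordinate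
  \<open>i\<close>, the second the other coordinate.\<close>

definition coords :: "2 \<Rightarrow> real \<times> real \<Rightarrow> real ^ 2" where
  "coords i = (\<lambda>(t, y). \<chi> k. if k = i then t else y)"

lemma coords_nth: "coords i (t, y) $ i = t" "j \<noteq> i \<Longrightarrow> coords i (t, y) $ j = y"
  by (simp_all add: coords_def)

lemma UNIV_2_eq: "i \<noteq> j \<Longrightarrow> (UNIV :: 2 set) = {i, j}"
  using exhaust_2 by (metis (full_types) UNIV_eq_I insertCI)

lemma all_2_eq: "i \<noteq> j \<Longrightarrow> (\<forall>k::2. P k) \<longleftrightarrow> P i \<and> P j"
  by (metis UNIV_2_eq UNIV_I insertE singletonD)

lemma Basis_2_eq: "i \<noteq> (j::2) \<Longrightarrow> (Basis :: (real^2) set) = {axis i 1, axis j 1}"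
  unfolding Basis_vec_def by (simp add: UNIV_2_eq insert_commute)

lemma ex_other_index: "\<exists>j::2. j \<noteq> i"
  by (metis exhaust_2 one_neq_zero)

lemma coords_eq: "i \<noteq> j \<Longrightarrow> coords i p = fst p *\<^sub>R axis i 1 + snd p *\<^sub>R axis j 1"
  by (cases p) (simp add: vec_eq_iff all_2_eq coords_nth, simp add: axis_def)

lemma borel_measurable_coords [measurable]:
  "coords i \<in> borel_measurable (lborel \<Otimes>\<^sub>M lborel)"
proof -
  obtain j :: 2 where "i \<noteq> j" using ex_other_index by metis
  then have "coords i = (\<lambda>p. fst p *\<^sub>R axis i 1 + snd p *\<^sub>R axis j 1)"
    by (simp add: fun_eq_iff coords_eq)
  then show ?thesis by simp
qed

text \<open>This transports Tonelli and Fubini, which concern product types, to \<open>real ^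
  2\<close>. Both measures give a box the product of its side lengths, and boxes determine Lebesgue
  measure.\<close>

lemma lborel_eq_distr_coords: "lborel = distr (lborel \<Otimes>\<^sub>M lborel) borel (coords i)"
proof (rule lborel_eqI)
  obtain j :: 2 where ij: "i \<noteq> j" by (metis ex_other_index)
  fix l u :: "real^2" assume le: "\<And>b. b \<in> Basis \<Longrightarrow> l \<bullet> b \<le> u \<bullet> b"
  have le': "l $ k \<le> u $ k" for k using le[of "axis k 1"] by (simp add: inner_axis)
  have "p \<in> coords i -` box l u \<longleftrightarrow> p \<in> {l $ i <..< u $ i} \<times> {l $ j <..< u $ j}" for p
    using ij by (cases p) (simp add: mem_box_cart all_2_eq[OF ij] coords_nth)
  then have "coords i -` box l u \<inter> space (lborel \<Otimes>\<^sub>M lborel) = {l $ i <..< u $ i} \<times> {l $ j <..< u $ j}"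
    by (auto simp: space_pair_measure)
  then show "emeasure (distr (lborel \<Otimes>\<^sub>M lborel) borel (coords i)) (box l u) = (\<Prod>b\<in>Basis. (u - l) \<bullet> b)"
    using ij le' by (simp add: emeasure_distr lborel.emeasure_pair_measure_Times Basis_2_eq[OF ij]
        inner_axis ennreal_mult axis_eq_axis)
qed simp

section \<open>Powers of the coordinates on squares\<close>

definition cube :: "real \<Rightarrow> (real ^ 2) set" where
  "cube R = {x. \<forall>k. \<bar>x $ k\<bar> \<le> R}"

lemma abs_le_bounds: "\<bar>t\<bar> \<le> R \<longleftrightarrow> - R \<le> t \<and> t \<le> (R::real)"
  by linarith

lemma cube_eq_cbox: "cube R = cbox (\<chi> k. - R) (\<chi> k. R)"
  by (simp add: set_eq_iff cube_def mem_box_cart abs_le_bounds)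

lemma cube_sets [measurable]: "cube R \<in> sets borel"
  by (simp add: cube_eq_cbox)

lemma borel_measurable_nth [measurable]: "(\<lambda>x::real ^ 2. x $ k) \<in> borel_measurable borel"
  by (intro borel_measurable_continuous_onI continuous_intros)

lemma compact_subset_cube:
  assumes "compact K" obtains R where "R \<ge> 0" "K \<subseteq> cube R"
proof -
  obtain R where R: "\<And>x. x \<in> K \<Longrightarrow> norm x \<le> R"
    using compact_imp_bounded[OF assms] bounded_iff by blast
  have "\<bar>x $ k\<bar> \<le> max R 0" if "x \<in> K" for x k
    using component_le_norm_cart[of x k] R[OF that] by linarith
  then have "K \<subseteq> cube (max R 0)" by (auto simp: cube_def)
  with that[of "max R 0"] show ?thesis by simp
qed

lemma coords_in_cube: "coords i (t, y) \<in> cube R \<longleftrightarrow> \<bar>t\<bar> \<le> R \<and> \<bar>y\<bar> \<le> R"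
proof -
  obtain j :: 2 where "j \<noteq> i" using ex_other_index by metis
  then show ?thesis by (simp add: cube_def all_2_eq[OF \<open>j \<noteq> i\<close>] coords_nth conj_commute)
qed

lemma integrable_lborel_coords:
  fixes f :: "real ^ 2 \<Rightarrow> real"
  assumes "f \<in> borel_measurable borel"
  shows "integrable lborel f \<longleftrightarrow> integrable (lborel \<Otimes>\<^sub>M lborel) (\<lambda>p. f (coords i p))"
  using integrable_distr_eq[OF borel_measurable_coords assms] lborel_eq_distr_coords[of i] by metis

lemma integral_lborel_coords:
  fixes f :: "real ^ 2 \<Rightarrow> real"
  assumes "f \<in> borel_measurable borel"
  shows "integral\<^sup>L lborel f = integral\<^sup>L (lborel \<Otimes>\<^sub>M lborel) (\<lambda>p. f (coords i p))"
  using integral_distr[OF borel_measurable_coords assms] lborel_eq_distr_coords[of i] by metis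

lemma nn_integral_lborel_coords:
  fixes f :: "real ^ 2 \<Rightarrow> ennreal"
  assumes [measurable]: "f \<in> borel_measurable borel"
  shows "integral\<^sup>N lborel f = (\<integral>\<^sup>+ t. \<integral>\<^sup>+ y. f (coords i (t, y)) \<partial>lborel \<partial>lborel)"
proof -
  have "integral\<^sup>N lborel f = integral\<^sup>N (lborel \<Otimes>\<^sub>M lborel) (\<lambda>p. f (coords i p))"
    by (subst lborel_eq_distr_coords[of i]) (rule nn_integral_distr; measurable)
  also have "\<dots> = (\<integral>\<^sup>+ t. \<integral>\<^sup>+ y. f (coords i (t, y)) \<partial>lborel \<partial>lborel)"
    by (rule lborel.nn_integral_fst[symmetric]) measurable
  finally show ?thesis .
qed

lemma nn_integral_abs_powr_interval:
  assumes "a < 1" "R \<ge> 0"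
  shows "(\<integral>\<^sup>+ t. ennreal (indicator {- R..R} t * \<bar>t\<bar> powr (- a)) \<partial>lborel)
           = ennreal (2 * R powr (1 - a) / (1 - a))"
proof -
  have *: "((\<lambda>t. t powr (- a)) has_integral (R powr (1 - a) / (1 - a))) {0..R}"
    using has_integral_powr_from_0[of "- a" R] assms by simp
  have right: "((\<lambda>t. \<bar>t\<bar> powr (- a)) has_integral (R powr (1 - a) / (1 - a))) {0..R}"
    by (rule has_integral_eq[OF _ *]) simp
  have left: "((\<lambda>t. \<bar>t\<bar> powr (- a)) has_integral (R powr (1 - a) / (1 - a))) {- R..0}"
    using has_integral_reflect_real[of "\<lambda>t. \<bar>t\<bar> powr (- a)" _ R 0] right by simp
  have "((\<lambda>t. \<bar>t\<bar> powr (- a)) has_integral (2 * R powr (1 - a) / (1 - a))) {- R..R}"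
    using has_integral_combine[OF _ _ left right] assms by simp
  then have "((\<lambda>t. if t \<in> {- R..R} then \<bar>t\<bar> powr (- a) else 0) has_integral (2 * R powr (1 - a) / (1 - a))) UNIV"
    by (rule has_integral_restrict_UNIV[THEN iffD2])
  then have I: "((\<lambda>t. indicator {- R..R} t * \<bar>t\<bar> powr (- a)) has_integral (2 * R powr (1 - a) / (1 - a))) UNIV"
    by (rule has_integral_eq[rotated]) simp
  show ?thesis
  proof (rule nn_integral_has_integral_lborel[OF _ _ I])
    show "(\<lambda>t. indicator {- R..R} t * \<bar>t\<bar> powr (- a)) \<in> borel_measurable borel"
      by measurable
  qed simp
qed

text \<open>The source of all integrability in this development: singularities are compared with
  products of powers of the two coordinates, so that one-dimensional integrals suffice. The exact
  dependence on \<open>R\<close> is what makes the \<open>BMO\<close> estimate scale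
  invariant.\<close>

lemma has_bochner_integral_abs_powr_cube:
  assumes "i \<noteq> j" "a < 1" "b < 1" "R \<ge> 0"
  shows "has_bochner_integral lborel
    (\<lambda>x. indicator (cube R) x * (\<bar>x $ i\<bar> powr (- a) * \<bar>x $ j\<bar> powr (- b)))
    (2 * R powr (1 - a) / (1 - a) * (2 * R powr (1 - b) / (1 - b)))"
proof (rule has_bochner_integral_nn_integral)
  have ind: "indicator (cube R) (coords i (t, y)) = (indicator {- R..R} t * indicator {- R..R} y :: real)" for t y
    by (simp add: indicator_def coords_in_cube abs_le_bounds)
  let ?p = "\<lambda>c t. indicator {- R..R} t * \<bar>t\<bar> powr (- c)"
  have split: "ennreal (indicator (cube R) (coords i (t, y)) *
      (\<bar>coords i (t, y) $ i\<bar> powr (- a) * \<bar>coords i (t, y) $ j\<bar> powr (- b)))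
      = ennreal (?p a t) * ennreal (?p b y)" for t y
    using assms(1) by (subst ennreal_mult'[symmetric]) (simp_all add: ind coords_nth)
  have "(\<integral>\<^sup>+ x. ennreal (indicator (cube R) x * (\<bar>x $ i\<bar> powr (- a) * \<bar>x $ j\<bar> powr (- b))) \<partial>lborel)
     = (\<integral>\<^sup>+ t. \<integral>\<^sup>+ y. ennreal (?p a t) * ennreal (?p b y) \<partial>lborel \<partial>lborel)"
    unfolding split[symmetric] by (rule nn_integral_lborel_coords) measurable
  also have "\<dots> = (\<integral>\<^sup>+ t. ennreal (?p a t) \<partial>lborel) * (\<integral>\<^sup>+ y. ennreal (?p b y) \<partial>lborel)"
    by (simp add: nn_integral_cmult nn_integral_multc)
  also have "\<dots> = ennreal (2 * R powr (1 - a) / (1 - a) * (2 * R powr (1 - b) / (1 - b)))"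
    using assms by (simp only: nn_integral_abs_powr_interval) (subst ennreal_mult'', simp_all)
  finally show "(\<integral>\<^sup>+ x. ennreal (indicator (cube R) x * (\<bar>x $ i\<bar> powr (- a) * \<bar>x $ j\<bar> powr (- b))) \<partial>lborel) =
    ennreal (2 * R powr (1 - a) / (1 - a) * (2 * R powr (1 - b) / (1 - b)))" .
  show "AE x in lborel. 0 \<le> indicator (cube R) x * (\<bar>x $ i\<bar> powr (- a) * \<bar>x $ j\<bar> powr (- b))"
    by (intro always_eventually allI mult_nonneg_nonneg) simp_all
  show "0 \<le> 2 * R powr (1 - a) / (1 - a) * (2 * R powr (1 - b) / (1 - b))"
    using assms by (intro mult_nonneg_nonneg divide_nonneg_nonneg) simp_all
  show "(\<lambda>x. indicator (cube R) x * (\<bar>x $ i\<bar> powr (- a) * \<bar>x $ j\<bar> powr (- b)))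
      \<in> borel_measurable lborel" by measurable
qed

section \<open>Weak derivatives from slices\<close>

text \<open>Local integrability with respect to Lebesgue measure on the Borel sets. Keeping Borel
  measurability as a separate clause allows slices and products to be measured without
  completions.\<close>

definition integrable_on_cubes :: "(real ^ 2 \<Rightarrow> real) \<Rightarrow> bool" where
  "integrable_on_cubes F \<longleftrightarrow> F \<in> borel_measurable borel
     \<and> (\<forall>R. integrable lborel (\<lambda>x. indicator (cube R) x * F x))"

lemma integrable_on_cubesD:
  assumes "integrable_on_cubes F"
  shows "F \<in> borel_measurable borel" "integrable lborel (\<lambda>x. indicator (cube R) x * F x)"
  using assms by (simp_all add: integrable_on_cubes_def)

lemma integrable_times_compact_support:
  fixes \<psi> :: "real ^ 2 \<Rightarrow> real"
  assumes F: "integrable_on_cubes F" and cont: "continuous_on UNIV \<psi>"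
    and K: "compact K" and off: "\<And>x. x \<notin> K \<Longrightarrow> \<psi> x = 0"
  shows "integrable lborel (\<lambda>x. F x * \<psi> x)"
proof -
  note [measurable] = integrable_on_cubesD(1)[OF F] borel_measurable_continuous_onI[OF cont]
  obtain R where R: "R \<ge> 0" "K \<subseteq> cube R" using compact_subset_cube[OF K] .
  have "bounded (\<psi> ` K)"
    using compact_imp_bounded[OF compact_continuous_image[OF continuous_on_subset[OF cont] K]] by simp
  then obtain B where B: "\<And>x. x \<in> K \<Longrightarrow> \<bar>\<psi> x\<bar> \<le> B" by (auto simp: bounded_iff)
  show ?thesis
  proof (rule Bochner_Integration.integrable_bound)
    show "integrable lborel (\<lambda>x. B * (indicator (cube R) x * F x))"
      using integrable_on_cubesD(2)[OF F] by simp
    show "(\<lambda>x. F x * \<psi> x) \<in> borel_measurable lborel" by measurable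
    have "\<bar>F x * \<psi> x\<bar> \<le> \<bar>B * (indicator (cube R) x * F x)\<bar>" for x
    proof (cases "x \<in> K")
      case True
      then have "\<bar>F x\<bar> * \<bar>\<psi> x\<bar> \<le> \<bar>F x\<bar> * \<bar>B\<bar>" using B[of x] by (intro mult_left_mono) auto
      then show ?thesis using True R by (auto simp: abs_mult mult.commute)
    qed (simp add: off)
    then show "AE x in lborel. norm (F x * \<psi> x) \<le> norm (B * (indicator (cube R) x * F x))" by simp
  qed
qed

text \<open>Outside the support the function vanishes on a neighbourhood, whence so does its
  derivative.\<close>

lemma test_function_facts:
  fixes \<phi> :: "'a::euclidean_space \<Rightarrow> real"
  assumes "\<phi> \<in> test_functions U" "b \<in> Basis"
  shows test_function_has_derivative: "(\<phi> has_derivative frechet_derivative \<phi> (at x)) (at x)"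
    and test_function_continuous: "continuous_on UNIV \<phi>"
    and test_function_partial_continuous: "continuous_on UNIV (partial_deriv b \<phi>)"
    and test_function_zero: "x \<notin> closure {x. \<phi> x \<noteq> 0} \<Longrightarrow> \<phi> x = 0"
    and test_function_partial_zero: "x \<notin> closure {x. \<phi> x \<noteq> 0} \<Longrightarrow> partial_deriv b \<phi> x = 0"
proof -
  have C: "C_k k \<phi>" for k using assms(1) by (simp add: test_functions_def)
  show "(\<phi> has_derivative frechet_derivative \<phi> (at x)) (at x)"
    using C[of "Suc 0"] frechet_derivative_works by auto
  show "continuous_on UNIV \<phi>" using C[of 0] by simp
  show "continuous_on UNIV (partial_deriv b \<phi>)" using C[of "Suc 0"] assms(2) by simp
  show zero: "\<phi> x = 0" if "x \<notin> closure {x. \<phi> x \<noteq> 0}" for x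
    using that subsetD[OF closure_subset, of x "{x. \<phi> x \<noteq> 0}"] by auto
  show "partial_deriv b \<phi> x = 0" if x: "x \<notin> closure {x. \<phi> x \<noteq> 0}"
  proof -
    have "(\<phi> has_derivative (\<lambda>_. 0)) (at x)"
    proof (rule has_derivative_transform_within_open[of "\<lambda>_. 0"])
      show "open (- closure {x. \<phi> x \<noteq> 0})" by (simp add: open_Compl)
      show "x \<in> - closure {x. \<phi> x \<noteq> 0}" using x by simp
      show "0 = \<phi> y" if "y \<in> - closure {x. \<phi> x \<noteq> 0}" for y
        using zero[of y] that by simp
    qed simp
    then show ?thesis
      unfolding partial_deriv_def by (metis frechet_derivative_at)
  qed
qed

lemma test_function_slice_derivative:
  assumes "\<phi> \<in> test_functions U"
  shows "((\<lambda>t. \<phi> (coords i (t, y))) has_real_derivative partial_deriv (axis i 1) \<phi> (coords i (t, y))) (at t)"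
proof -
  obtain j :: 2 where ij: "i \<noteq> j" using ex_other_index by metis
  have b: "axis i 1 \<in> (Basis :: (real^2) set)" by (simp add: axis_in_Basis_iff)
  have "((\<lambda>t. coords i (t, y)) has_derivative (\<lambda>h. h *\<^sub>R axis i 1)) (at t)"
    unfolding coords_eq[OF ij] by (auto intro!: derivative_eq_intros)
  from has_derivative_compose[OF this test_function_has_derivative[OF assms b]]
  have "((\<lambda>t. \<phi> (coords i (t, y))) has_derivative
      (\<lambda>h. frechet_derivative \<phi> (at (coords i (t, y))) (h *\<^sub>R axis i 1))) (at t)" .
  moreover have "linear (frechet_derivative \<phi> (at (coords i (t, y))))"
    by (rule has_derivative_linear[OF test_function_has_derivative[OF assms b]])
  then have "frechet_derivative \<phi> (at (coords i (t, y))) (h *\<^sub>R axis i 1)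
      = partial_deriv (axis i 1) \<phi> (coords i (t, y)) * h" for h
    by (simp add: linear_cmul partial_deriv_def)
  ultimately show ?thesis
    by (simp add: has_field_derivative_def)
qed

lemma continuous_on_coords: "continuous_on UNIV (\<lambda>t. coords i (t, y))"
proof -
  obtain j :: 2 where ij: "i \<noteq> j" using ex_other_index by metis
  show ?thesis unfolding coords_eq[OF ij] by (intro continuous_intros)
qed

text \<open>On almost every line parallel to axis \<open>i\<close>, namely on those that miss the
  other axis, \<open>F\<close> is continuous and differentiable except at one point. The fundamental
  theorem of calculus tolerates that point, so \<open>F \<phi>\<close>, which vanishes far out, has
  a derivative of integral zero on each such line; Fubini collects the lines.\<close>

lemma integral_by_parts_slices:
  assumes F: "integrable_on_cubes F" and g: "integrable_on_cubes g"
    and cont: "\<And>y. y \<noteq> 0 \<Longrightarrow> continuous_on UNIV (\<lambda>t. F (coords i (t, y)))"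
    and deriv: "\<And>t y. y \<noteq> 0 \<Longrightarrow> t \<noteq> 0 \<Longrightarrow>
      ((\<lambda>t. F (coords i (t, y))) has_real_derivative g (coords i (t, y))) (at t)"
    and \<phi>: "\<phi> \<in> test_functions UNIV"
  shows "(\<integral>x. F x * partial_deriv (axis i 1) \<phi> x \<partial>lborel) = - (\<integral>x. g x * \<phi> x \<partial>lborel)"
proof -
  let ?\<psi> = "partial_deriv (axis i 1) \<phi>"
  have b: "axis i 1 \<in> (Basis :: (real^2) set)" by (simp add: axis_in_Basis_iff)
  note tf = test_function_facts[OF \<phi> b]
  define K where "K = closure {x. \<phi> x \<noteq> 0}"
  have K: "compact K" using \<phi> by (simp add: K_def test_functions_def)
  obtain R where R: "R \<ge> 0" "K \<subseteq> cube R" using compact_subset_cube[OF K] .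
  have offK: "\<phi> x = 0" "?\<psi> x = 0" if "x \<notin> K" for x
    using that unfolding K_def by (fact tf(4), fact tf(5))
  have off: "\<phi> x = 0" "?\<psi> x = 0" if "x \<notin> cube R" for x
    using offK[of x] that R by blast+
  have iF: "integrable lborel (\<lambda>x. F x * ?\<psi> x)"
    by (rule integrable_times_compact_support[OF F tf(3) K offK(2)])
  have ig: "integrable lborel (\<lambda>x. g x * \<phi> x)"
    by (rule integrable_times_compact_support[OF g tf(2) K offK(1)])
  define h where "h = (\<lambda>x. F x * ?\<psi> x + g x * \<phi> x)"
  have ih: "integrable lborel h" unfolding h_def using iF ig by simp
  have [measurable]: "h \<in> borel_measurable borel" using borel_measurable_integrable[OF ih] by simp
  have curry: "(\<lambda>(t, y). h (coords i (t, y))) = (\<lambda>p. h (coords i p))" by (simp add: fun_eq_iff)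
  have ic: "integrable (lborel \<Otimes>\<^sub>M lborel) (\<lambda>(t, y). h (coords i (t, y)))"
    unfolding curry using ih integrable_lborel_coords[of h i] by simp
  have zero: "(\<integral>t. h (coords i (t, y)) \<partial>lborel) = 0"
    if y: "y \<noteq> 0" and int: "integrable lborel (\<lambda>t. h (coords i (t, y)))" for y
  proof -
    let ?u = "\<lambda>t. F (coords i (t, y)) * \<phi> (coords i (t, y))"
    let ?v = "\<lambda>t. h (coords i (t, y))"
    \<comment> \<open>The margin 1 puts the end points outside the support.\<close>
    have "(?v has_integral (?u (R + 1) - ?u (- (R + 1)))) {- (R + 1)..R + 1}"
    proof (rule fundamental_theorem_of_calculus_strong[of "{0}"])
      show "- (R + 1) \<le> R + 1" using R by simp
      have "continuous_on UNIV ?u"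
        by (intro continuous_on_mult cont y continuous_on_compose2[OF tf(2) continuous_on_coords] subset_UNIV)
      then show "continuous_on {- (R + 1)..R + 1} ?u"
        by (rule continuous_on_subset) simp
      fix t :: real assume "t \<in> {- (R + 1)..R + 1} - {0}"
      then have "(?u has_real_derivative ?v t) (at t)"
        unfolding h_def using DERIV_mult[OF deriv[OF y, of t] test_function_slice_derivative[OF \<phi>, of i y t]]
        by (simp add: algebra_simps)
      then show "(?u has_vector_derivative ?v t) (at t)"
        by (simp add: has_real_derivative_iff_has_vector_derivative)
    qed simp
    moreover have out: "\<phi> (coords i (t, y)) = 0" "?\<psi> (coords i (t, y)) = 0" if "R < \<bar>t\<bar>" for t
      using that by (simp_all add: off coords_in_cube)
    ultimately have I: "(?v has_integral 0) {- (R + 1)..R + 1}"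
      using R by (simp only: out abs_minus_cancel mult_zero_right diff_self)
    have "?v t = 0" if "t \<notin> {- (R + 1)..R + 1}" for t
    proof -
      have "R < \<bar>t\<bar>" using that by auto
      then show ?thesis by (simp add: h_def out)
    qed
    then have "(?v has_integral 0) UNIV"
      by (intro has_integral_on_superset[OF I]) simp_all
    with has_integral_integral_lborel[OF int] show ?thesis
      by (rule has_integral_unique)
  qed
  have "AE y in lborel. y \<noteq> (0::real)" by (rule AE_lborel_singleton)
  then have "AE y in lborel. (\<integral>t. h (coords i (t, y)) \<partial>lborel) = 0"
    using lborel_pair.AE_integrable_snd[OF ic]
  proof eventually_elim
    case (elim y)
    then show ?case by (rule zero)
  qed
  then have "(\<integral>y. \<integral>t. h (coords i (t, y)) \<partial>lborel \<partial>lborel) = 0"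
    by (rule integral_eq_zero_AE)
  then have "integral\<^sup>L lborel h = 0"
    using lborel_pair.integral_snd[OF ic] integral_lborel_coords[of h i] by (simp add: curry)
  then show ?thesis unfolding h_def using iF ig by simp
qed

lemma lebesgue_on_borel:
  fixes f :: "real ^ 2 \<Rightarrow> real"
  assumes U: "U \<in> sets borel" and f: "f \<in> borel_measurable borel"
  shows integrable_lebesgue_on_borel:
      "integrable (lebesgue_on U) f \<longleftrightarrow> integrable lborel (\<lambda>x. indicator U x * f x)"
    and integral_lebesgue_on_borel:
      "integral\<^sup>L (lebesgue_on U) f = (\<integral>x. indicator U x * f x \<partial>lborel)"
proof -
  have m: "(\<lambda>x. indicator U x * f x) \<in> borel_measurable lborel" using U f by simp
  have U': "U \<inter> space lebesgue \<in> sets lebesgue" using U sets_completionI_sets by simp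
  show "integrable (lebesgue_on U) f \<longleftrightarrow> integrable lborel (\<lambda>x. indicator U x * f x)"
    using integrable_restrict_space[OF U', of f] integrable_completion[OF m] by simp
  show "integral\<^sup>L (lebesgue_on U) f = (\<integral>x. indicator U x * f x \<partial>lborel)"
    using integral_restrict_space[OF U', of f] integral_completion[OF m] by simp
qed

lemma borel_measurable_lebesgue_on:
  "f \<in> borel_measurable borel \<Longrightarrow> f \<in> borel_measurable (lebesgue_on U)"
  by (intro measurable_restrict_space1 measurable_completion) simp

lemma integrable_indicator_subset_cube:
  assumes int: "integrable lborel (\<lambda>x. indicator (cube R) x * f x :: real)"
    and U: "U \<in> sets borel" "U \<subseteq> cube R"
  shows "integrable lborel (\<lambda>x. indicator U x * f x)"
proof -
  have "integrable lborel (\<lambda>x. indicator U x *\<^sub>R (indicator (cube R) x * f x))"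
    using integrable_mult_indicator[OF _ int, of U] U by simp
  moreover have "(\<lambda>x. indicator U x *\<^sub>R (indicator (cube R) x * f x)) = (\<lambda>x. indicator U x * f x)"
    using U(2) by (auto simp: fun_eq_iff indicator_def)
  ultimately show ?thesis by (simp only:)
qed

lemma locally_integrable_if_cubes:
  assumes "integrable_on_cubes f"
  shows "locally_integrable U f"
  unfolding locally_integrable_def
proof (intro allI impI, elim conjE)
  fix K assume K: "compact K" "K \<subseteq> U"
  then have "K \<in> sets borel" by (simp add: borel_closed compact_imp_closed)
  obtain R where "K \<subseteq> cube R" using compact_subset_cube[OF K(1)] .
  then show "integrable (lebesgue_on K) f"
    using integrable_indicator_subset_cube[OF integrable_on_cubesD(2)[OF assms] \<open>K \<in> sets borel\<close>]
      integrable_lebesgue_on_borel[OF \<open>K \<in> sets borel\<close> integrable_on_cubesD(1)[OF assms]] by simp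
qed

text \<open>Test functions of \<open>U\<close>, extended by zero, are test functions of the plane,
  so the integration by parts on the whole plane covers every \<open>U\<close>.\<close>

lemma weak_partial_deriv_slices:
  assumes F: "integrable_on_cubes F" and g: "integrable_on_cubes g"
    and cont: "\<And>y. y \<noteq> 0 \<Longrightarrow> continuous_on UNIV (\<lambda>t. F (coords i (t, y)))"
    and deriv: "\<And>t y. y \<noteq> 0 \<Longrightarrow> t \<noteq> 0 \<Longrightarrow>
      ((\<lambda>t. F (coords i (t, y))) has_real_derivative g (coords i (t, y))) (at t)"
    and U: "U \<in> sets borel"
  shows "weak_partial_deriv U (axis i 1) F g"
  unfolding weak_partial_deriv_def
proof (intro conjI ballI locally_integrable_if_cubes[OF F] locally_integrable_if_cubes[OF g])
  fix \<phi> assume \<phi>: "\<phi> \<in> test_functions U"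
  have b: "axis i 1 \<in> (Basis :: (real^2) set)" by (simp add: axis_in_Basis_iff)
  have \<phi>': "\<phi> \<in> test_functions UNIV" and sub: "closure {x. \<phi> x \<noteq> 0} \<subseteq> U"
    using \<phi> by (simp_all add: test_functions_def)
  note tf = test_function_facts[OF \<phi> b]
  note [measurable] = integrable_on_cubesD(1)[OF F] integrable_on_cubesD(1)[OF g]
    borel_measurable_continuous_onI[OF tf(2)] borel_measurable_continuous_onI[OF tf(3)]
  have off: "\<phi> x = 0" "partial_deriv (axis i 1) \<phi> x = 0" if "x \<notin> U" for x
    using that sub by (blast intro: tf(4), blast intro: tf(5))
  then have off: "indicator U x * (F x * partial_deriv (axis i 1) \<phi> x) = F x * partial_deriv (axis i 1) \<phi> x"
    "indicator U x * (g x * \<phi> x) = g x * \<phi> x" for x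
    by (cases "x \<in> U"; simp)+
  have "(\<integral>x. F x * partial_deriv (axis i 1) \<phi> x \<partial>lebesgue_on U)
      = (\<integral>x. F x * partial_deriv (axis i 1) \<phi> x \<partial>lborel)"
    by (subst integral_lebesgue_on_borel[OF U]) (simp_all only: off, measurable)
  also have "\<dots> = - (\<integral>x. g x * \<phi> x \<partial>lborel)"
    by (rule integral_by_parts_slices[OF F g cont deriv \<phi>'])
  also have "(\<integral>x. g x * \<phi> x \<partial>lborel) = (\<integral>x. g x * \<phi> x \<partial>lebesgue_on U)"
    by (subst integral_lebesgue_on_borel[OF U]) (simp_all only: off, measurable)
  finally show "(\<integral>x. F x * partial_deriv (axis i 1) \<phi> x \<partial>lebesgue_on U)
      = - (\<integral>x. g x * \<phi> x \<partial>lebesgue_on U)" .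
qed

text \<open>The counterpart of \<open>integrable_on_cubes\<close> for the exponent \<open>p\<close>:
  it yields membership in \<open>Lp_space p U\<close> for all bounded open \<open>U\<close> at
  once.\<close>

definition Lp_on_cubes :: "real \<Rightarrow> (real ^ 2 \<Rightarrow> real) \<Rightarrow> bool" where
  "Lp_on_cubes p f \<longleftrightarrow> f \<in> borel_measurable borel
     \<and> (\<forall>R. integrable lborel (\<lambda>x. indicator (cube R) x * \<bar>f x\<bar> powr p))"

lemma integrable_on_cubes_if_Lp_1:
  assumes "Lp_on_cubes 1 f"
  shows "integrable_on_cubes f"
  unfolding integrable_on_cubes_def
proof (intro conjI allI)
  show [measurable]: "f \<in> borel_measurable borel" using assms by (simp add: Lp_on_cubes_def)
  fix R
  have int: "integrable lborel (\<lambda>x. indicator (cube R) x * \<bar>f x\<bar> powr 1)"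
    using assms by (simp add: Lp_on_cubes_def)
  show "integrable lborel (\<lambda>x. indicator (cube R) x * f x)"
    by (rule Bochner_Integration.integrable_bound[OF int]) (simp_all add: abs_mult)
qed

lemma Lp_space_if_cubes:
  assumes f: "Lp_on_cubes p f" and U: "open U" "U \<subseteq> cube R"
  shows "f \<in> Lp_space p U"
proof -
  have m [measurable]: "f \<in> borel_measurable borel"
    and int: "integrable lborel (\<lambda>x. indicator (cube R) x * \<bar>f x\<bar> powr p)"
    using f by (simp_all add: Lp_on_cubes_def)
  have "U \<in> sets borel" using U(1) by simp
  moreover have "(\<lambda>x. \<bar>f x\<bar> powr p) \<in> borel_measurable borel" by measurable
  ultimately have "integrable (lebesgue_on U) (\<lambda>x. \<bar>f x\<bar> powr p)"
    using integrable_indicator_subset_cube[OF int _ U(2)] integrable_lebesgue_on_borel by blast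
  then show ?thesis using borel_measurable_lebesgue_on[OF m] by (simp add: Lp_space_def)
qed

lemma open_compactly_contained_subset_cube:
  assumes "compactly_contained U (\<Omega> :: (real ^ 2) set)"
  obtains R where "R \<ge> 0" "U \<subseteq> cube R"
  using compact_subset_cube[of "closure U"] assms closure_subset[of U]
  unfolding compactly_contained_def by (metis subset_trans)

lemma W1p_loc_if_slices:
  assumes "Lp_on_cubes p F" "\<And>i. Lp_on_cubes p (g i)" "Lp_on_cubes 1 F" "\<And>i. Lp_on_cubes 1 (g i)"
    and cont: "\<And>i y. y \<noteq> 0 \<Longrightarrow> continuous_on UNIV (\<lambda>t. F (coords i (t, y)))"
    and deriv: "\<And>i t y. y \<noteq> 0 \<Longrightarrow> t \<noteq> 0 \<Longrightarrow>
      ((\<lambda>t. F (coords i (t, y))) has_real_derivative g i (coords i (t, y))) (at t)"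
  shows "F \<in> W1p_loc p UNIV"
  unfolding W1p_loc_def mem_Collect_eq
proof (intro allI impI, elim conjE)
  fix U :: "(real ^ 2) set" assume U: "open U" "compactly_contained U UNIV"
  obtain R where R: "U \<subseteq> cube R" using open_compactly_contained_subset_cube[OF U(2)] .
  have "weak_partial_deriv U (axis i 1) F (g i)" for i
    using U(1) assms(3,4) cont deriv
    by (intro weak_partial_deriv_slices integrable_on_cubes_if_Lp_1) simp_all
  then have "\<exists>g'\<in>Lp_space p U. weak_partial_deriv U (axis i 1) F g'" for i
    using Lp_space_if_cubes[OF assms(2) U(1) R] by metis
  then show "F \<in> W1p p U"
    using Lp_space_if_cubes[OF assms(1) U(1) R] by (auto simp: W1p_def Basis_vec_def)
qed

lemma AE_lborel_nth_neq_0: "AE x in lborel. (x :: real ^ 2) $ i \<noteq> 0"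
proof -
  have m: "{x :: real ^ 2. x $ i = 0} \<in> sets lborel" by measurable
  have "{x :: real ^ 2. x $ i = 0} \<in> null_sets lebesgue"
    using negligible_standard_hyperplane_cart[of i] by (simp add: negligible_iff_null_sets)
  then have "{x :: real ^ 2. x $ i = 0} \<in> null_sets lborel"
    using m emeasure_completion[of "{x :: real ^ 2. x $ i = 0}" lborel] by (simp add: null_sets_def)
  then show ?thesis by (rule AE_I') simp
qed

text \<open>The bound is only asked for off the axes, a null set, because the power \<open>0 powr
  a\<close> has the value \<open>0\<close> for every exponent and could make it false there.\<close>

lemma Lp_on_cubes_if_dominated:
  assumes m [measurable]: "f \<in> borel_measurable borel" and p: "p \<ge> 1"
    and ij: "i \<noteq> j" and ab: "a * p < 1" "b * p < 1"
    and bound: "\<And>R. R \<ge> 0 \<Longrightarrow> \<exists>C. \<forall>x\<in>cube R. x $ i \<noteq> 0 \<longrightarrow> x $ j \<noteq> 0 \<longrightarrow>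
      \<bar>f x\<bar> \<le> C * (\<bar>x $ i\<bar> powr (- a) * \<bar>x $ j\<bar> powr (- b))"
  shows "Lp_on_cubes p f"
  unfolding Lp_on_cubes_def
proof (intro conjI allI m)
  fix R :: real
  show "integrable lborel (\<lambda>x. indicator (cube R) x * \<bar>f x\<bar> powr p)"
  proof (cases "R \<ge> 0")
    case False
    then have "cube R = {}" by (auto simp: cube_def)
    then show ?thesis by simp
  next
    case True
    obtain C where C: "\<And>x. x \<in> cube R \<Longrightarrow> x $ i \<noteq> 0 \<Longrightarrow> x $ j \<noteq> 0 \<Longrightarrow>
        \<bar>f x\<bar> \<le> C * (\<bar>x $ i\<bar> powr (- a) * \<bar>x $ j\<bar> powr (- b))"
      using bound[OF True] by blast
    let ?h = "\<lambda>x. indicator (cube R) x * (\<bar>x $ i\<bar> powr (- (a * p)) * \<bar>x $ j\<bar> powr (- (b * p)))"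
    have int: "integrable lborel (\<lambda>x. \<bar>C\<bar> powr p * ?h x)"
      using has_bochner_integral_abs_powr_cube[OF ij ab True]
      by (intro integrable_mult_right) (rule has_bochner_integral_iff[THEN iffD1, THEN conjunct1])
    have le: "\<bar>f x\<bar> powr p \<le> \<bar>C\<bar> powr p * (\<bar>x $ i\<bar> powr (- (a * p)) * \<bar>x $ j\<bar> powr (- (b * p)))"
      if "x \<in> cube R" "x $ i \<noteq> 0" "x $ j \<noteq> 0" for x
    proof -
      have "\<bar>f x\<bar> \<le> \<bar>C\<bar> * (\<bar>x $ i\<bar> powr (- a) * \<bar>x $ j\<bar> powr (- b))"
        using C[OF that] mult_right_mono[OF abs_ge_self[of C], of "\<bar>x $ i\<bar> powr (- a) * \<bar>x $ j\<bar> powr (- b)"] by simp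
      then have "\<bar>f x\<bar> powr p \<le> (\<bar>C\<bar> * (\<bar>x $ i\<bar> powr (- a) * \<bar>x $ j\<bar> powr (- b))) powr p"
        using p by (intro powr_mono2) simp_all
      also have "\<dots> = \<bar>C\<bar> powr p * (\<bar>x $ i\<bar> powr (- (a * p)) * \<bar>x $ j\<bar> powr (- (b * p)))"
        by (simp add: powr_mult powr_powr)
      finally show ?thesis .
    qed
    show ?thesis
    proof (rule Bochner_Integration.integrable_bound[OF int])
      show "(\<lambda>x. indicator (cube R) x * \<bar>f x\<bar> powr p) \<in> borel_measurable lborel" by measurable
      show "AE x in lborel. norm (indicator (cube R) x * \<bar>f x\<bar> powr p) \<le> norm (\<bar>C\<bar> powr p * ?h x)"
        using AE_lborel_nth_neq_0[of i] AE_lborel_nth_neq_0[of j]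
      proof eventually_elim
        case (elim x)
        then show ?case using le[of x] by (cases "x \<in> cube R") (simp_all add: abs_mult)
      qed
    qed
  qed
qed

section \<open>Smooth bumps\<close>

text \<open>The functions arising from \<open>exp (- 1 / t)\<close> by differentiation, extended by
  zero to \<open>t \<le> 0\<close>. The polynomial keeps track of the factor in \<open>1 / t\<close>
  that each derivative produces, so the family is closed under differentiation.\<close>

definition flat :: "real poly \<Rightarrow> real \<Rightarrow> real" where
  "flat P t = (if t > 0 then poly P (1 / t) * exp (- 1 / t) else 0)"

lemma tendsto_poly_times_exp_minus: "((\<lambda>x::real. poly P x * exp (- x)) \<longlongrightarrow> 0) at_top"
proof -
  have "((\<lambda>x. \<Sum>k\<le>degree P. coeff P k * (x ^ k / exp x)) \<longlongrightarrow> 0) at_top"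
    by (intro tendsto_null_sum tendsto_mult_right_zero tendsto_power_div_exp_0)
  then show ?thesis
    by (simp add: poly_altdef sum_distrib_right exp_minus divide_inverse mult.assoc)
qed

text \<open>At \<open>0\<close> the difference quotient from the right is \<open>Q(u) exp (-
  u)\<close> with \<open>u = 1 / t\<close> and a polynomial \<open>Q\<close>, and the exponential
  wins.\<close>

lemma flat_has_derivative:
  "(flat P has_real_derivative flat (monom 1 2 * (P - pderiv P)) t) (at t)"
proof -
  consider "t > 0" | "t < 0" | "t = 0" by linarith
  then show ?thesis
  proof cases
    case 1
    have "((\<lambda>t. poly P (1 / t) * exp (- 1 / t)) has_real_derivative flat (monom 1 2 * (P - pderiv P)) t) (at t)"
      using 1 by (auto intro!: derivative_eq_intros simp: flat_def poly_monom field_simps power2_eq_square)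
    then show ?thesis
      by (rule has_field_derivative_transform_within_open[of _ _ _ "{0<..}"]) (use 1 in \<open>auto simp: flat_def\<close>)
  next
    case 2
    have "((\<lambda>t. 0) has_real_derivative flat (monom 1 2 * (P - pderiv P)) t) (at t)"
      using 2 by (simp add: flat_def)
    then show ?thesis
      by (rule has_field_derivative_transform_within_open[of _ _ _ "{..<0}"]) (use 2 in \<open>auto simp: flat_def\<close>)
  next
    case 3
    have "((\<lambda>y. poly (pCons 0 P) (inverse y) * exp (- inverse y)) \<longlongrightarrow> 0) (at_right (0::real))"
      by (rule filterlim_compose[OF tendsto_poly_times_exp_minus filterlim_inverse_at_top_right])
    then have "((\<lambda>y. flat P y / y) \<longlongrightarrow> 0) (at_right 0)"
    proof (rule Lim_transform_eventually)
      show "\<forall>\<^sub>F y in at_right 0. poly (pCons 0 P) (inverse y) * exp (- inverse y) = flat P y / y"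
        using eventually_at_right_less[of 0]
        by eventually_elim (simp add: flat_def divide_inverse mult_ac)
    qed
    moreover have "((\<lambda>y. flat P y / y) \<longlongrightarrow> 0) (at_left 0)"
    proof (rule Lim_transform_eventually[OF tendsto_const])
      show "\<forall>\<^sub>F y in at_left 0. 0 = flat P y / y"
        by (rule eventually_at_leftI[of "-1"]) (simp_all add: flat_def)
    qed
    ultimately have "((\<lambda>y. flat P y / y) \<longlongrightarrow> 0) (at 0)"
      by (simp add: filterlim_split_at)
    then show ?thesis
      using 3 by (simp add: has_field_derivative_iff flat_def)
  qed
qed

text \<open>The algebra generated by constants and flat functions of affine forms. It is closed
  under partial derivatives, which yields smoothness of all orders without a Leibniz formula for
  iterated derivatives.\<close>

inductive_set flat_algebra :: "('a::euclidean_space \<Rightarrow> real) set" where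
  const: "(\<lambda>x. c) \<in> flat_algebra"
| flat: "(\<lambda>x. flat P (x \<bullet> v + b)) \<in> flat_algebra"
| add: "f \<in> flat_algebra \<Longrightarrow> g \<in> flat_algebra \<Longrightarrow> (\<lambda>x. f x + g x) \<in> flat_algebra"
| mult: "f \<in> flat_algebra \<Longrightarrow> g \<in> flat_algebra \<Longrightarrow> (\<lambda>x. f x * g x) \<in> flat_algebra"

lemma flat_algebra_derivative:
  assumes "f \<in> flat_algebra"
  shows "\<exists>D. (\<forall>x. (f has_derivative D x) (at x)) \<and> (\<forall>u. (\<lambda>x. D x u) \<in> flat_algebra)"
  using assms
proof induction
  case (const c)
  then show ?case by (intro exI[of _ "\<lambda>_ _. 0"]) (auto intro: flat_algebra.const)
next
  case (flat P v b)
  let ?Q = "monom 1 2 * (P - pderiv P)"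
  show ?case
  proof (intro exI conjI allI)
    fix x
    have "((\<lambda>x. x \<bullet> v + b) has_derivative (\<lambda>u. u \<bullet> v)) (at x)"
      by (auto intro!: derivative_eq_intros)
    from has_derivative_compose[OF this flat_has_derivative[unfolded has_field_derivative_def]]
    show "((\<lambda>x. flat P (x \<bullet> v + b)) has_derivative (\<lambda>u. flat ?Q (x \<bullet> v + b) * (u \<bullet> v))) (at x)" .
  next
    fix u :: 'a
    show "(\<lambda>x. flat ?Q (x \<bullet> v + b) * (u \<bullet> v)) \<in> flat_algebra"
      by (intro flat_algebra.intros)
  qed
next
  case (add f g)
  then obtain D E where D: "\<And>x. (f has_derivative D x) (at x)" "\<And>u. (\<lambda>x. D x u) \<in> flat_algebra"
    and E: "\<And>x. (g has_derivative E x) (at x)" "\<And>u. (\<lambda>x. E x u) \<in> flat_algebra" by blast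
  show ?case
    by (intro exI[of _ "\<lambda>x u. D x u + E x u"] conjI allI has_derivative_add D(1) E(1)
        flat_algebra.add D(2) E(2))
next
  case (mult f g)
  then obtain D E where D: "\<And>x. (f has_derivative D x) (at x)" "\<And>u. (\<lambda>x. D x u) \<in> flat_algebra"
    and E: "\<And>x. (g has_derivative E x) (at x)" "\<And>u. (\<lambda>x. E x u) \<in> flat_algebra" by blast
  show ?case
    by (intro exI[of _ "\<lambda>x u. f x * E x u + D x u * g x"] conjI allI has_derivative_mult D(1) E(1)
        flat_algebra.add flat_algebra.mult D(2) E(2) mult.hyps)
qed

lemma flat_algebra_C_k: "f \<in> flat_algebra \<Longrightarrow> C_k k f"
proof (induction k arbitrary: f)
  case 0
  obtain D where "\<And>x. (f has_derivative D x) (at x)" using flat_algebra_derivative[OF 0] by blast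
  then show ?case by (auto intro!: continuous_at_imp_continuous_on has_derivative_continuous)
next
  case (Suc k)
  obtain D where D: "\<And>x. (f has_derivative D x) (at x)" "\<And>u. (\<lambda>x. D x u) \<in> flat_algebra"
    using flat_algebra_derivative[OF Suc.prems] by blast
  have "partial_deriv u f = (\<lambda>x. D x u)" for u
    by (simp add: partial_deriv_def fun_eq_iff frechet_derivative_at[OF D(1), symmetric])
  then show ?case using D Suc.IH by (auto simp: differentiable_def)
qed

text \<open>The lower left corner \<open>a\<close> and the side lengths \<open>l\<close> describe
  the box that carries the bump.\<close>

definition bump :: "real ^ 2 \<Rightarrow> real ^ 2 \<Rightarrow> real ^ 2 \<Rightarrow> real" where
  "bump a l x = (\<Prod>k\<in>UNIV. flat 1 ((x $ k - a $ k) / l $ k) * flat 1 (1 - (x $ k - a $ k) / l $ k))"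

lemma bump_in_flat_algebra: "bump a l \<in> flat_algebra"
proof -
  have affine: "(x $ k - a $ k) / l $ k = x \<bullet> axis k (1 / l $ k) + (- (a $ k / l $ k))"
    "1 - (x $ k - a $ k) / l $ k = x \<bullet> axis k (- 1 / l $ k) + (1 + a $ k / l $ k)" for x k
    by (simp_all add: inner_axis diff_divide_distrib)
  have "bump a l = (\<lambda>x. (flat 1 (x \<bullet> axis 1 (1 / l $ 1) + (- (a $ 1 / l $ 1))) *
          flat 1 (x \<bullet> axis 1 (- 1 / l $ 1) + (1 + a $ 1 / l $ 1))) *
        (flat 1 (x \<bullet> axis 2 (1 / l $ 2) + (- (a $ 2 / l $ 2))) *
          flat 1 (x \<bullet> axis 2 (- 1 / l $ 2) + (1 + a $ 2 / l $ 2))))"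
    unfolding affine[symmetric] by (simp add: bump_def[abs_def] UNIV_2)
  then show ?thesis
    by (simp only:) (intro flat_algebra.intros)
qed

lemma flat_1_bounds: "0 \<le> flat 1 t" "flat 1 t \<le> 1" "t \<le> 0 \<Longrightarrow> flat 1 t = 0"
    "1/4 \<le> t \<Longrightarrow> exp (- 4) \<le> flat 1 t"
  by (simp_all add: flat_def) (simp add: field_simps)

lemma bump_bounds: "0 \<le> bump a l x" "bump a l x \<le> 1"
  unfolding bump_def
  by (intro prod_nonneg mult_nonneg_nonneg flat_1_bounds ballI)
    (intro prod_le_1 conjI mult_nonneg_nonneg mult_le_one flat_1_bounds)

lemma bump_nonzero_in_box:
  assumes "\<And>k. l $ k > 0" "bump a l x \<noteq> 0"
  shows "x \<in> box a (a + l)"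
proof -
  have "a $ k < x $ k \<and> x $ k < a $ k + l $ k" for k
  proof -
    have "flat 1 ((x $ k - a $ k) / l $ k) \<noteq> 0" "flat 1 (1 - (x $ k - a $ k) / l $ k) \<noteq> 0"
      using assms(2) by (auto simp: bump_def)
    then have "0 < (x $ k - a $ k) / l $ k" "0 < 1 - (x $ k - a $ k) / l $ k"
      using flat_1_bounds(3) linorder_not_le by blast+
    then show ?thesis using assms(1)[of k] by (simp add: field_simps zero_less_divide_iff)
  qed
  then show ?thesis by (simp add: mem_box_cart)
qed

lemma bump_test_function:
  assumes "\<And>k. l $ k > 0" "cbox a (a + l) \<subseteq> U"
  shows "bump a l \<in> test_functions U"
proof -
  have "closure {x. bump a l x \<noteq> 0} \<subseteq> cbox a (a + l)"
    using bump_nonzero_in_box[OF assms(1)] box_subset_cbox by (intro closure_minimal) fastforce+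
  moreover from this have "compact (closure {x. bump a l x \<noteq> 0})"
    by (meson bounded_cbox bounded_subset closed_closure compact_eq_bounded_closed)
  ultimately show ?thesis
    using flat_algebra_C_k[OF bump_in_flat_algebra] assms(2) by (auto simp: test_functions_def)
qed

text \<open>On the concentric box of half the size the four factors are at least \<open>exp (-
  4)\<close> each. The point of the bound is that it is proportional to the area of the box with a
  universal constant.\<close>

lemma bump_integral_ge:
  assumes l: "\<And>k. l $ k > 0"
  shows "exp (- 16) / 4 * (l $ 1 * l $ 2) \<le> (\<integral>x. bump a l x \<partial>lborel)"
proof -
  have "C_k 0 (bump a l)" by (rule flat_algebra_C_k[OF bump_in_flat_algebra])
  then have [measurable]: "bump a l \<in> borel_measurable borel"
    by (intro borel_measurable_continuous_onI) simp
  have int: "integrable lborel (bump a l)"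
  proof (rule Bochner_Integration.integrable_bound)
    show "integrable lborel (indicator (cbox a (a + l)) :: _ \<Rightarrow> real)"
      by (intro integrable_real_indicator emeasure_lborel_cbox_finite) simp
    show "AE x in lborel. norm (bump a l x) \<le> norm (indicator (cbox a (a + l)) x :: real)"
    proof (intro always_eventually allI)
      fix x
      show "norm (bump a l x) \<le> norm (indicator (cbox a (a + l)) x :: real)"
        using bump_bounds[of a l x] bump_nonzero_in_box[OF l, of a x] box_subset_cbox[of a "a + l"]
        by (cases "bump a l x = 0") (auto simp: indicator_def)
    qed
  qed simp
  let ?B = "cbox (a + (1/4) *\<^sub>R l) (a + (3/4) *\<^sub>R l)"
  have le: "exp (- 16) * indicator ?B x \<le> bump a l x" for x
  proof (cases "x \<in> ?B")
    case True
    have s: "1/4 \<le> (x $ k - a $ k) / l $ k" "1/4 \<le> 1 - (x $ k - a $ k) / l $ k" for k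
      using True l[of k] by (auto simp: mem_box_cart field_simps dest: spec[of _ k])
    have "(\<Prod>k\<in>(UNIV::2 set). exp (- 4) * exp (- 4)) \<le> bump a l x"
      unfolding bump_def using s
      by (intro prod_mono conjI mult_mono flat_1_bounds) simp_all
    moreover have "(\<Prod>k\<in>(UNIV::2 set). exp (- 4) * exp (- 4)) = exp (- 16 :: real)"
      by (simp add: mult_exp_exp UNIV_2)
    ultimately show ?thesis using True by simp
  qed (simp add: bump_bounds)
  have B: "integrable lborel (indicator ?B :: _ \<Rightarrow> real)"
    by (intro integrable_real_indicator emeasure_lborel_cbox_finite) simp
  have "?B \<noteq> {}" using l by (simp add: interval_ne_empty_cart less_imp_le)
  then have "measure lborel ?B = l $ 1 * l $ 2 / 4"
    by (simp add: content_cbox_cart UNIV_2)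
  then have "exp (- 16) / 4 * (l $ 1 * l $ 2) = (\<integral>x. exp (- 16) * indicator ?B x \<partial>lborel)"
    by simp
  also have "\<dots> \<le> (\<integral>x. bump a l x \<partial>lborel)"
    using B int by (intro integral_mono le) simp_all
  finally show "exp (- 16) / 4 * (l $ 1 * l $ 2) \<le> (\<integral>x. bump a l x \<partial>lborel)" .
qed

section \<open>A criterion for failing to be Sobolev\<close>

text \<open>A pointwise substitute for Hoelder's inequality: small values are cut off at
  \<open>c\<close>, large ones are paid for by their \<open>p\<close>-th power.\<close>

lemma le_threshold_plus_powr:
  fixes x :: real
  assumes "c > 0" "p \<ge> 1"
  shows "x \<le> c + c powr (1 - p) * \<bar>x\<bar> powr p"
proof (cases "\<bar>x\<bar> \<le> c")
  case True
  have "x \<le> c" using True by simp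
  moreover have "0 \<le> c powr (1 - p) * \<bar>x\<bar> powr p" by simp
  ultimately show ?thesis by linarith
next
  case False
  then have "\<bar>x\<bar> powr (1 - p) \<le> c powr (1 - p)"
    using assms by (intro powr_mono2') simp_all
  then have "\<bar>x\<bar> powr (1 - p) * \<bar>x\<bar> powr p \<le> c powr (1 - p) * \<bar>x\<bar> powr p"
    by (rule mult_right_mono) simp
  moreover have "\<bar>x\<bar> powr (1 - p) * \<bar>x\<bar> powr p = \<bar>x\<bar>"
    using False assms by (simp add: powr_add[symmetric])
  ultimately show ?thesis using assms by linarith
qed

text \<open>A weak derivative is only determined almost everywhere, but its integral against
  \<open>\<phi>\<close> is the same for \<open>g\<close> and \<open>h\<close>. Hence
  \<open>h\<close> has mean at least \<open>m\<close> with respect to \<open>\<phi>\<close>. The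
  part of \<open>h\<close> below the threshold \<open>m / 2\<close> accounts for at most half of it,
  and the rest is controlled by the \<open>p\<close>-th power. This replaces the uniqueness of weak
  derivatives.\<close>

lemma weak_derivative_Lp_lower_bound:
  fixes F g h \<phi> :: "real ^ 2 \<Rightarrow> real"
  assumes p: "p \<ge> 1" and U: "U \<in> sets borel"
    and wg: "weak_partial_deriv U b F g" and wh: "weak_partial_deriv U b F h"
    and h: "h \<in> Lp_space p U" and g: "integrable_on_cubes g"
    and \<phi>: "\<phi> \<in> test_functions U" "\<And>x. 0 \<le> \<phi> x" "\<And>x. \<phi> x \<le> 1" "\<And>x. x \<notin> Q \<Longrightarrow> \<phi> x = 0"
    and Q: "Q \<in> sets borel" "Q \<subseteq> U"
    and m: "m > 0" "\<And>x. x \<in> Q \<Longrightarrow> m \<le> g x"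
  shows "(m / 2) powr p * (\<integral>x. \<phi> x \<partial>lborel) \<le> (\<integral>x. indicator Q x * \<bar>h x\<bar> powr p \<partial>lebesgue_on U)"
proof -
  have b: "axis 1 1 \<in> (Basis :: (real^2) set)" by (simp add: axis_in_Basis_iff)
  note tf = test_function_facts[OF \<phi>(1) b]
  have K: "compact (closure {x. \<phi> x \<noteq> 0})" using \<phi>(1) by (simp add: test_functions_def)
  note [measurable] = integrable_on_cubesD(1)[OF g] borel_measurable_continuous_onI[OF tf(2)]
  have h_meas [measurable]: "h \<in> borel_measurable (lebesgue_on U)"
    and h_int: "integrable (lebesgue_on U) (\<lambda>x. \<bar>h x\<bar> powr p)"
    using h by (simp_all add: Lp_space_def)
  have phi_meas [measurable]: "\<phi> \<in> borel_measurable (lebesgue_on U)"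
    by (rule borel_measurable_lebesgue_on) measurable
  have offU: "\<phi> x = 0" if "x \<notin> U" for x using that Q(2) \<phi>(4) by blast
  have off: "indicator U x * \<phi> x = \<phi> x" "indicator U x * (g x * \<phi> x) = g x * \<phi> x" for x
    using offU[of x] by (cases "x \<in> U"; simp)+
  have "Q \<in> sets lebesgue" using Q(1) by simp
  then have QU: "Q \<in> sets (lebesgue_on U)" using Q(2) U
    by (subst sets_restrict_space_iff) (simp_all add: Int_absorb1)
  have g\<phi>_lborel: "integrable lborel (\<lambda>x. g x * \<phi> x)"
    by (rule integrable_times_compact_support[OF g tf(2) K tf(4)])
  have "integrable_on_cubes (\<lambda>_. 1)"
    unfolding integrable_on_cubes_def cube_eq_cbox mult_1_right
    by (intro conjI allI integrable_real_indicator emeasure_lborel_cbox_finite) simp_all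
  from integrable_times_compact_support[OF this tf(2) K tf(4)]
  have \<phi>_lborel: "integrable lborel \<phi>" by simp
  have int_\<phi>: "integrable (lebesgue_on U) \<phi>"
    using \<phi>_lborel by (subst integrable_lebesgue_on_borel[OF U]) (simp_all add: off)
  have int_g\<phi>: "integrable (lebesgue_on U) (\<lambda>x. g x * \<phi> x)"
    using g\<phi>_lborel by (subst integrable_lebesgue_on_borel[OF U]) (simp_all add: off)
  have int_Q: "integrable (lebesgue_on U) (\<lambda>x. indicator Q x * \<bar>h x\<bar> powr p)"
    using integrable_mult_indicator[OF QU h_int] by simp
  \<comment> \<open>With half of m as threshold, half of the mean survives.\<close>
  define c where "c = m / 2"
  have c: "c > 0" using m by (simp add: c_def)
  let ?r = "\<lambda>x. c * \<phi> x + c powr (1 - p) * (indicator Q x * \<bar>h x\<bar> powr p)"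
  have le: "\<bar>h x\<bar> * \<phi> x \<le> ?r x" for x
  proof (cases "x \<in> Q")
    case True
    have "\<bar>h x\<bar> * \<phi> x \<le> (c + c powr (1 - p) * \<bar>h x\<bar> powr p) * \<phi> x"
      using le_threshold_plus_powr[OF c p, of "\<bar>h x\<bar>"] \<phi>(2) by (intro mult_right_mono) simp_all
    also have "\<dots> = c * \<phi> x + c powr (1 - p) * \<bar>h x\<bar> powr p * \<phi> x" by (simp add: distrib_right)
    also have "c powr (1 - p) * \<bar>h x\<bar> powr p * \<phi> x \<le> c powr (1 - p) * \<bar>h x\<bar> powr p * 1"
      using \<phi>(3) by (intro mult_left_mono) simp_all
    finally show ?thesis using True by simp
  qed (simp add: \<phi>(4))
  have int_r: "integrable (lebesgue_on U) ?r" using int_\<phi> int_Q by simp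
  have int_h\<phi>: "integrable (lebesgue_on U) (\<lambda>x. h x * \<phi> x)"
  proof (rule Bochner_Integration.integrable_bound[OF int_r])
    show "AE x in lebesgue_on U. norm (h x * \<phi> x) \<le> norm (?r x)"
    proof (intro always_eventually allI)
      fix x
      have "norm (h x * \<phi> x) = \<bar>h x\<bar> * \<phi> x" using \<phi>(2)[of x] by (simp add: abs_mult)
      also have "\<dots> \<le> norm (?r x)" using le[of x] abs_ge_self[of "?r x"] by (simp only: real_norm_def)
      finally show "norm (h x * \<phi> x) \<le> norm (?r x)" .
    qed
  qed measurable
  let ?I = "\<integral>x. \<phi> x \<partial>lebesgue_on U" and ?J = "\<integral>x. indicator Q x * \<bar>h x\<bar> powr p \<partial>lebesgue_on U"
  have "m * ?I = (\<integral>x. m * \<phi> x \<partial>lebesgue_on U)" by simp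
  also have "\<dots> \<le> (\<integral>x. g x * \<phi> x \<partial>lebesgue_on U)"
  proof (rule integral_mono)
    fix x show "m * \<phi> x \<le> g x * \<phi> x"
      using m(2)[of x] \<phi>(2,4)[of x] by (cases "x \<in> Q") (simp_all add: mult_right_mono)
  qed (use int_\<phi> int_g\<phi> in simp_all)
  also have "\<dots> = (\<integral>x. h x * \<phi> x \<partial>lebesgue_on U)"
    using wg wh \<phi>(1) unfolding weak_partial_deriv_def by fastforce
  also have "\<dots> \<le> (\<integral>x. ?r x \<partial>lebesgue_on U)"
  proof (rule integral_mono[OF int_h\<phi> int_r])
    fix x
    have "h x * \<phi> x \<le> \<bar>h x\<bar> * \<phi> x" using \<phi>(2)[of x] by (intro mult_right_mono) simp_all
    then show "h x * \<phi> x \<le> ?r x" using le[of x] by linarith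
  qed
  also have "\<dots> = c * ?I + c powr (1 - p) * ?J" using int_\<phi> int_Q by simp
  finally have "c * ?I \<le> c powr (1 - p) * ?J" by (simp add: c_def)
  then have "c powr (p - 1) * (c * ?I) \<le> c powr (p - 1) * (c powr (1 - p) * ?J)"
    by (rule mult_left_mono) simp
  also have "c powr (p - 1) * (c powr (1 - p) * ?J) = ?J"
    using c by (simp add: mult.assoc[symmetric] powr_add[symmetric])
  also have "c powr (p - 1) * (c * ?I) = c powr p * ?I"
    using c by (simp add: powr_diff)
  also have "?I = (\<integral>x. \<phi> x \<partial>lborel)"
    by (subst integral_lebesgue_on_borel[OF U]) (simp_all add: off)
  finally show ?thesis by (simp add: c_def)
qed

text \<open>Boxes that eventually leave every point, on which a \<open>p\<close>-integrable weak
  derivative \<open>h\<close> would nevertheless keep a fixed amount of the integral of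
  \<open>\<bar>h\<bar> powr p\<close>, contradict dominated convergence.\<close>

lemma not_W1p_loc_if_blowup:
  fixes F g :: "real ^ 2 \<Rightarrow> real" and a l :: "nat \<Rightarrow> real ^ 2"
  assumes p: "p \<ge> 1" and g: "integrable_on_cubes g"
    and weak: "\<And>U. U \<in> sets borel \<Longrightarrow> weak_partial_deriv U (axis i 1) F g"
    and l: "\<And>n k. l n $ k > 0" and R: "\<And>n. cbox (a n) (a n + l n) \<subseteq> cube R"
    and m: "\<And>n. m n > 0" "\<And>n x. x \<in> box (a n) (a n + l n) \<Longrightarrow> m n \<le> g x"
    and c: "c > 0" "\<And>n. c \<le> m n powr p * (l n $ 1 * l n $ 2)"
    and shrink: "\<And>x. \<forall>\<^sub>F n in sequentially. x \<notin> box (a n) (a n + l n)"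
  shows "F \<notin> W1p_loc p UNIV"
proof
  assume F: "F \<in> W1p_loc p UNIV"
  define U :: "(real ^ 2) set" where "U = box (\<chi> k. - (R + 1)) (\<chi> k. R + 1)"
  have U: "open U" "U \<in> sets borel" by (simp_all add: U_def open_box)
  have sub: "cube R \<subseteq> U"
    unfolding U_def
  proof
    fix x assume "x \<in> cube R"
    then have "\<bar>x $ k\<bar> \<le> R" for k by (simp add: cube_def)
    then have "- (R + 1) < x $ k \<and> x $ k < R + 1" for k
      using order_trans[OF abs_ge_self, of "x $ k" R] order_trans[OF abs_ge_minus_self, of "x $ k" R] by force
    then show "x \<in> box (\<chi> k. - (R + 1)) (\<chi> k. R + 1)" by (simp add: mem_box_cart)
  qed
  have "compactly_contained U UNIV" by (simp add: compactly_contained_def U_def)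
  with F U have "F \<in> W1p p U" by (simp add: W1p_loc_def)
  then have "\<forall>b\<in>Basis. \<exists>h\<in>Lp_space p U. weak_partial_deriv U b F h" by (simp add: W1p_def)
  moreover have "axis i 1 \<in> (Basis :: (real ^ 2) set)" by (simp add: axis_in_Basis_iff)
  ultimately obtain h where h: "h \<in> Lp_space p U" "weak_partial_deriv U (axis i 1) F h" by metis
  define Q where "Q n = box (a n) (a n + l n)" for n
  have Q: "Q n \<in> sets borel" "Q n \<subseteq> U" for n
    using R[of n] sub box_subset_cbox[of "a n" "a n + l n"] by (auto simp: Q_def)
  define J where "J n = (\<integral>x. indicator (Q n) x * \<bar>h x\<bar> powr p \<partial>lebesgue_on U)" for n
  let ?c = "(1 / 2) powr p * (exp (- 16) / 4) * c"
  have lower: "?c \<le> J n" for n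
  proof -
    let ?I = "\<integral>x. bump (a n) (l n) x \<partial>lborel"
    have "?c \<le> (1 / 2) powr p * (exp (- 16) / 4) * (m n powr p * (l n $ 1 * l n $ 2))"
      using c(2)[of n] by (intro mult_left_mono) simp_all
    also have "\<dots> = (m n / 2) powr p * (exp (- 16) / 4 * (l n $ 1 * l n $ 2))"
      using m(1)[of n] by (simp add: powr_divide)
    also have "\<dots> \<le> (m n / 2) powr p * ?I"
      by (intro mult_left_mono bump_integral_ge l) simp
    also have "\<dots> \<le> J n"
      unfolding J_def
    proof (rule weak_derivative_Lp_lower_bound[OF p U(2) weak[OF U(2)] h(2,1) g])
      show "bump (a n) (l n) \<in> test_functions U"
        using R[of n] sub by (intro bump_test_function l) simp
      show "bump (a n) (l n) x = 0" if "x \<notin> Q n" for x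
        using bump_nonzero_in_box[OF l, where a = "a n" and x = x] that unfolding Q_def by blast
    qed (use Q m in \<open>auto simp: bump_bounds Q_def\<close>)
    finally show ?thesis .
  qed
  have h': "h \<in> borel_measurable (lebesgue_on U)" "integrable (lebesgue_on U) (\<lambda>x. \<bar>h x\<bar> powr p)"
    using h(1) by (simp_all add: Lp_space_def)
  note [measurable] = h'(1)
  have QU [measurable]: "Q n \<in> sets (lebesgue_on U)" for n
    using Q[of n] U by (subst sets_restrict_space_iff) (simp_all add: Int_absorb1)
  have "J \<longlonglongrightarrow> (\<integral>x. 0 \<partial>lebesgue_on U)"
    unfolding J_def
  proof (rule integral_dominated_convergence[OF _ _ h'(2)])
    show "AE x in lebesgue_on U. (\<lambda>n. indicator (Q n) x * \<bar>h x\<bar> powr p) \<longlonglongrightarrow> 0"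
    proof (intro always_eventually allI)
      fix x
      have "\<forall>\<^sub>F n in sequentially. indicator (Q n) x * \<bar>h x\<bar> powr p = 0"
        using shrink[of x] by eventually_elim (simp add: Q_def)
      then show "(\<lambda>n. indicator (Q n) x * \<bar>h x\<bar> powr p) \<longlonglongrightarrow> 0"
        by (rule tendsto_eventually)
    qed
    show "AE x in lebesgue_on U. norm (indicator (Q n) x * \<bar>h x\<bar> powr p) \<le> \<bar>h x\<bar> powr p" for n
      by (intro always_eventually allI) (simp add: indicator_def)
  qed measurable
  then have "?c \<le> 0"
    using lower by (intro LIMSEQ_le_const[of J]) auto
  moreover have "?c > 0" using c(1) by simp
  ultimately show False by linarith
qed

section \<open>The gradient of w\<close>

lemma abs_powr_has_derivative:
  assumes "t \<noteq> (0::real)"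
  shows "((\<lambda>t. \<bar>t\<bar> powr a) has_real_derivative a * (sgn t * \<bar>t\<bar> powr (a - 1))) (at t)"
proof (cases "t > 0")
  case True
  then have "((\<lambda>t. t powr a) has_real_derivative a * (sgn t * \<bar>t\<bar> powr (a - 1))) (at t)"
    using has_real_derivative_powr[of t a] by simp
  then show ?thesis
    by (rule has_field_derivative_transform_within_open[of _ _ _ "{0<..}"]) (use True in simp_all)
next
  case False
  then have "t < 0" using assms by simp
  have "((\<lambda>t. - t) has_real_derivative - 1) (at t)" by (auto intro!: derivative_eq_intros)
  from DERIV_fun_powr[OF this, of a]
  have "((\<lambda>t. (- t) powr a) has_real_derivative a * (sgn t * \<bar>t\<bar> powr (a - 1))) (at t)"
    using \<open>t < 0\<close> by simp
  then show ?thesis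
    by (rule has_field_derivative_transform_within_open[of _ _ _ "{..<0}"]) (use \<open>t < 0\<close> in simp_all)
qed

lemma abs_powr_has_derivative_gt_1:
  assumes "a > 1"
  shows "((\<lambda>t. \<bar>t\<bar> powr a) has_real_derivative a * (sgn t * \<bar>t\<bar> powr (a - 1))) (at t)"
proof (cases "t = 0")
  case True
  have "((\<lambda>y. \<bar>y\<bar> powr (a - 1)) \<longlongrightarrow> \<bar>0\<bar> powr (a - 1)) (at (0::real))"
    using assms by (intro tendsto_powr' tendsto_intros) simp_all
  then have lim: "((\<lambda>y. \<bar>y\<bar> powr (a - 1)) \<longlongrightarrow> 0) (at (0::real))" by simp
  have "((\<lambda>y. \<bar>y\<bar> powr a / y) \<longlongrightarrow> 0) (at 0)"
  proof (rule Lim_null_comparison[OF _ lim])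
    have "norm (\<bar>y\<bar> powr a / y) \<le> \<bar>y\<bar> powr (a - 1)" for y :: real
      by (cases "y = 0") (simp_all add: powr_diff)
    then show "\<forall>\<^sub>F y in at 0. norm (\<bar>y\<bar> powr a / y) \<le> \<bar>y\<bar> powr (a - 1)" by simp
  qed
  then show ?thesis using True by (simp add: has_field_derivative_iff)
qed (rule abs_powr_has_derivative)

text \<open>Homogeneous of degree \<open>2/3\<close>: up to bounded factors \<open>rad x\<close> is
  \<open>norm x powr (2/3)\<close>.\<close>

definition rad :: "real ^ 2 \<Rightarrow> real" where
  "rad x = \<bar>x $ 1\<bar> powr (2/3) + \<bar>x $ 2\<bar> powr (2/3)"

lemma grad_eqI: "GDERIV f x :> D \<Longrightarrow> grad f x = D"
  unfolding grad_def
proof (rule the_equality)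
  fix D' assume "GDERIV f x :> D" "GDERIV f x :> D'"
  then have "(\<lambda>h. inner h D) = (\<lambda>h. inner h D')"
    unfolding gderiv_def by (rule has_derivative_unique)
  then show "D' = D" by (metis inner_commute vector_eq_rdot)
qed

text \<open>Each partial derivative of \<open>w\<close> is \<open>4/3\<close> times a signed power
  of one coordinate with exponent \<open>1/3\<close>, also where the coordinate vanishes, because
  \<open>4/3\<close> exceeds \<open>1\<close>.\<close>

lemma norm_grad_w: "norm (grad w x) = 4/3 * sqrt (rad x)"
proof -
  define v where "v t = 4/3 * (sgn t * \<bar>t\<bar> powr (1/3))" for t :: real
  have v: "((\<lambda>t. \<bar>t\<bar> powr (4/3)) has_derivative (*) (v t)) (at t)" for t :: real
    using abs_powr_has_derivative_gt_1[of "4/3" t]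
    unfolding has_field_derivative_def v_def by simp
  have v_sq: "(v t)\<^sup>2 = (4/3)\<^sup>2 * \<bar>t\<bar> powr (2/3)" for t
  proof (cases "t = 0")
    case False
    have "(\<bar>t\<bar> powr (1/3))\<^sup>2 = \<bar>t\<bar> powr (2/3)"
      by (simp add: power2_eq_square powr_add[symmetric])
    moreover have "(sgn t)\<^sup>2 = 1" using False by (simp add: sgn_if)
    ultimately show ?thesis unfolding v_def power_mult_distrib by simp
  qed (simp add: v_def)
  define D :: "real ^ 2" where "D = (\<chi> k. if k = 1 then v (x $ 1) else - v (x $ 2))"
  have coord: "((\<lambda>x :: real ^ 2. x $ k) has_derivative (\<lambda>h. h $ k)) (at x)" for k
    by (rule bounded_linear_imp_has_derivative[OF bounded_linear_vec_nth])
  have "(w has_derivative (\<lambda>h. v (x $ 1) * (h $ 1) - v (x $ 2) * (h $ 2))) (at x)"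
    unfolding w_def[abs_def]
    by (intro has_derivative_diff has_derivative_compose[OF coord v])
  moreover have "(\<lambda>h. v (x $ 1) * (h $ 1) - v (x $ 2) * (h $ 2)) = (\<lambda>h. inner h D)"
    by (simp add: fun_eq_iff D_def inner_vec_def UNIV_2 mult.commute)
  ultimately have "grad w x = D" by (intro grad_eqI) (simp add: gderiv_def)
  then have "norm (grad w x) = sqrt ((v (x $ 1))\<^sup>2 + (v (x $ 2))\<^sup>2)"
    by (simp add: D_def norm_vec_def L2_set_def UNIV_2)
  also have "\<dots> = 4/3 * sqrt (rad x)"
    by (simp add: v_sq rad_def distrib_left[symmetric] real_sqrt_mult del: power_divide)
  finally show ?thesis .
qed

lemma rad_eq: "i \<noteq> j \<Longrightarrow> rad x = \<bar>x $ i\<bar> powr (2/3) + \<bar>x $ j\<bar> powr (2/3)"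
  using exhaust_2[of i] exhaust_2[of j] by (auto simp: rad_def)

lemma rad_nonneg: "0 \<le> rad x"
  by (simp add: rad_def)

lemma abs_powr_le_rad: "\<bar>x $ i\<bar> powr (2/3) \<le> rad x"
  using exhaust_2[of i] by (auto simp: rad_def)

lemma rad_pos: "x $ i \<noteq> 0 \<Longrightarrow> 0 < rad x"
  using abs_powr_le_rad[of x i] by (smt (verit) powr_gt_zero zero_less_abs_iff)

lemma rad_le_cube:
  assumes "x \<in> cube R" shows "rad x \<le> 2 * R powr (2/3)"
proof -
  have "\<bar>x $ k\<bar> powr (2/3) \<le> R powr (2/3)" for k
    using assms by (intro powr_mono2) (simp_all add: cube_def)
  from this[of 1] this[of 2] show ?thesis by (simp add: rad_def)
qed

lemma rad_coords: "rad (coords i (t, y)) = \<bar>t\<bar> powr (2/3) + \<bar>y\<bar> powr (2/3)"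
proof -
  obtain j :: 2 where "j \<noteq> i" using ex_other_index by metis
  then show ?thesis by (simp add: rad_eq[of i j] coords_nth)
qed

lemma borel_measurable_rad [measurable]: "rad \<in> borel_measurable borel"
  unfolding rad_def[abs_def] by measurable

section \<open>Functions of rad and their weak derivatives\<close>

text \<open>The partial derivative of \<open>G (rad x)\<close> when \<open>G' s = 3/2 * C * s powr
  (\<alpha> / 2 - 1)\<close>, by the chain rule. The value \<open>\<alpha> = 0\<close> belongs to
  the logarithm.\<close>

definition radial_deriv :: "real \<Rightarrow> real \<Rightarrow> 2 \<Rightarrow> real ^ 2 \<Rightarrow> real" where
  "radial_deriv \<alpha> C i x = C * rad x powr (\<alpha> / 2 - 1) * (sgn (x $ i) * \<bar>x $ i\<bar> powr (- (1/3)))"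

lemma borel_measurable_radial_deriv [measurable]: "radial_deriv \<alpha> C i \<in> borel_measurable borel"
  unfolding radial_deriv_def[abs_def] by measurable

lemma
  assumes G: "\<And>s. s > 0 \<Longrightarrow> (G has_real_derivative 3/2 * C * s powr (\<alpha> / 2 - 1)) (at s)"
    and y: "y \<noteq> 0"
  shows radial_slice_continuous: "continuous_on UNIV (\<lambda>t. G (rad (coords i (t, y))))"
    and radial_slice_derivative: "t \<noteq> 0 \<Longrightarrow>
      ((\<lambda>t. G (rad (coords i (t, y)))) has_real_derivative radial_deriv \<alpha> C i (coords i (t, y))) (at t)"
proof -
  have pos: "\<bar>t\<bar> powr (2/3) + \<bar>y\<bar> powr (2/3) > 0" for t
    using y by (simp add: add_nonneg_pos)
  have "continuous_on {0<..} G"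
    using G by (intro continuous_at_imp_continuous_on ballI) (auto intro: DERIV_isCont)
  moreover have "continuous_on UNIV (\<lambda>t. \<bar>t\<bar> powr (2/3) + \<bar>y\<bar> powr (2/3))"
    by (intro continuous_on_add continuous_on_powr' continuous_intros) simp_all
  ultimately show "continuous_on UNIV (\<lambda>t. G (rad (coords i (t, y))))"
    unfolding rad_coords by (rule continuous_on_compose2) (use pos in auto)
  assume t: "t \<noteq> 0"
  have "((\<lambda>t. \<bar>t\<bar> powr (2/3) + \<bar>y\<bar> powr (2/3)) has_real_derivative 2/3 * (sgn t * \<bar>t\<bar> powr (- (1/3)))) (at t)"
    using DERIV_add[OF abs_powr_has_derivative[OF t, of "2/3"] DERIV_const, of "\<bar>y\<bar> powr (2/3)"] by simp
  from DERIV_chain2[OF G[OF pos] this]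
  show "((\<lambda>t. G (rad (coords i (t, y)))) has_real_derivative radial_deriv \<alpha> C i (coords i (t, y))) (at t)"
    unfolding rad_coords radial_deriv_def coords_nth by (simp add: mult_ac)
qed

text \<open>The derivative has degree \<open>- d\<close> with \<open>d = 1 - \<alpha> / 3\<close>.
  For \<open>\<alpha> < 2\<close> the negative power of \<open>rad\<close> can be split between the
  coordinates in any ratio; the total exponent is \<open>d\<close>, and coordinate \<open>i\<close>
  must carry at least the \<open>1/3\<close> it already has. Splitting as evenly as this allows
  leaves both exponents below \<open>1 / p\<close>, since \<open>p < 3\<close> and \<open>p * d <
  2\<close>. For \<open>\<alpha> \<ge> 2\<close> the power of \<open>rad\<close> is bounded.\<close>

lemma radial_deriv_dominated:
  assumes \<alpha>: "0 \<le> \<alpha>" and ij: "i \<noteq> j" and p: "1 \<le> p" "p < 3" "p * (3 - \<alpha>) < 6"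
  obtains a b where "a * p < 1" "b * p < 1"
    "\<And>R. R \<ge> 0 \<Longrightarrow> \<exists>K. \<forall>x\<in>cube R. x $ i \<noteq> 0 \<longrightarrow> x $ j \<noteq> 0 \<longrightarrow>
      \<bar>radial_deriv \<alpha> C i x\<bar> \<le> K * (\<bar>x $ i\<bar> powr (- a) * \<bar>x $ j\<bar> powr (- b))"
proof (cases "\<alpha> < 2")
  case False
  show thesis
  proof (rule that[of "1/3" 0])
    fix R :: real assume "R \<ge> 0"
    show "\<exists>K. \<forall>x\<in>cube R. x $ i \<noteq> 0 \<longrightarrow> x $ j \<noteq> 0 \<longrightarrow>
      \<bar>radial_deriv \<alpha> C i x\<bar> \<le> K * (\<bar>x $ i\<bar> powr (- (1/3)) * \<bar>x $ j\<bar> powr (- 0))"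
    proof (intro exI ballI impI)
      fix x assume x: "x \<in> cube R" "x $ i \<noteq> 0" "x $ j \<noteq> 0"
      have "rad x powr (\<alpha> / 2 - 1) \<le> (2 * R powr (2/3)) powr (\<alpha> / 2 - 1)"
        using False rad_le_cube[OF x(1)] rad_nonneg by (intro powr_mono2) simp_all
      then have "\<bar>C\<bar> * rad x powr (\<alpha> / 2 - 1) * \<bar>x $ i\<bar> powr (- (1/3))
          \<le> \<bar>C\<bar> * (2 * R powr (2/3)) powr (\<alpha> / 2 - 1) * \<bar>x $ i\<bar> powr (- (1/3))"
        by (intro mult_right_mono mult_left_mono) simp_all
      then show "\<bar>radial_deriv \<alpha> C i x\<bar>
          \<le> \<bar>C\<bar> * (2 * R powr (2/3)) powr (\<alpha> / 2 - 1) * (\<bar>x $ i\<bar> powr (- (1/3)) * \<bar>x $ j\<bar> powr (- 0))"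
        using x by (simp add: radial_deriv_def abs_mult abs_sgn_eq)
    qed
  qed (use p in simp_all)
next
  case True
  define d where "d = 1 - \<alpha> / 3"
  \<comment> \<open>The even split, unless coordinate i alone needs more than half.\<close>
  define a where "a = max (1/3) (d / 2)"
  define b where "b = d - a"
  have pd: "p * d < 2" using p by (simp add: d_def field_simps)
  have ab: "a + b = d" "1/3 \<le> a" "b \<le> d / 2" "0 \<le> b"
    using True \<alpha> by (auto simp: a_def b_def d_def max_def field_simps)
  show thesis
  proof (rule that[of a b])
    show "a * p < 1" using p pd by (simp add: a_def max_def mult.commute)
    have "b * p \<le> d / 2 * p" using p ab(3) by (intro mult_right_mono) simp_all
    then show "b * p < 1" using pd by (simp add: mult.commute)
    fix R :: real assume "R \<ge> 0"
    show "\<exists>K. \<forall>x\<in>cube R. x $ i \<noteq> 0 \<longrightarrow> x $ j \<noteq> 0 \<longrightarrow>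
      \<bar>radial_deriv \<alpha> C i x\<bar> \<le> K * (\<bar>x $ i\<bar> powr (- a) * \<bar>x $ j\<bar> powr (- b))"
    proof (intro exI ballI impI)
      fix x assume x: "x \<in> cube R" "x $ i \<noteq> 0" "x $ j \<noteq> 0"
      have le: "rad x powr (- (3/2 * c)) \<le> \<bar>x $ k\<bar> powr (- c)" if "c \<ge> 0" "x $ k \<noteq> 0" for c k
      proof -
        have "rad x powr (- (3/2 * c)) \<le> (\<bar>x $ k\<bar> powr (2/3)) powr (- (3/2 * c))"
          using that abs_powr_le_rad by (intro powr_mono2') simp_all
        then show ?thesis by (simp add: powr_powr)
      qed
      \<comment> \<open>A power of rad with exponent 3/2 * c is worth exponent c in a coordinate.\<close>
      have "\<alpha> / 2 - 1 = - (3/2 * (a - 1/3)) + - (3/2 * b)"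
        using ab(1) by (simp add: d_def field_simps)
      then have "rad x powr (\<alpha> / 2 - 1) = rad x powr (- (3/2 * (a - 1/3))) * rad x powr (- (3/2 * b))"
        by (simp only: powr_add)
      also have "\<dots> \<le> \<bar>x $ i\<bar> powr (- (a - 1/3)) * \<bar>x $ j\<bar> powr (- b)"
        using x ab by (intro mult_mono le) simp_all
      finally have "\<bar>C\<bar> * rad x powr (\<alpha> / 2 - 1) * \<bar>x $ i\<bar> powr (- (1/3))
          \<le> \<bar>C\<bar> * (\<bar>x $ i\<bar> powr (- (a - 1/3)) * \<bar>x $ j\<bar> powr (- b)) * \<bar>x $ i\<bar> powr (- (1/3))"
        by (intro mult_right_mono mult_left_mono) simp_all
      also have "\<dots> = \<bar>C\<bar> * (\<bar>x $ i\<bar> powr (- a) * \<bar>x $ j\<bar> powr (- b))"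
        using powr_add[of "\<bar>x $ i\<bar>" "- (a - 1/3)" "- (1/3)"] by (simp add: mult_ac)
      finally show "\<bar>radial_deriv \<alpha> C i x\<bar> \<le> \<bar>C\<bar> * (\<bar>x $ i\<bar> powr (- a) * \<bar>x $ j\<bar> powr (- b))"
        using x by (simp add: radial_deriv_def abs_mult abs_sgn_eq)
    qed
  qed
qed

lemma radial_deriv_Lp:
  assumes "0 \<le> \<alpha>" "1 \<le> p" "p < 3" "p * (3 - \<alpha>) < 6"
  shows "Lp_on_cubes p (radial_deriv \<alpha> C i)"
proof -
  obtain j :: 2 where ij: "i \<noteq> j" using ex_other_index by metis
  show ?thesis
    using radial_deriv_dominated[OF assms(1) ij assms(2-4), of C]
      Lp_on_cubes_if_dominated[OF borel_measurable_radial_deriv assms(2) ij] by metis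
qed

text \<open>A logarithm is below any power. The exponent \<open>- (1/2)\<close> turns
  \<open>rad\<close> into the integrable singularity \<open>\<bar>x $ 1\<bar> powr (-
  (1/3))\<close>.\<close>

lemma abs_ln_le:
  assumes "s > (0::real)"
  shows "\<bar>ln s\<bar> \<le> s + 2 * s powr (- (1/2))"
proof -
  have "ln s \<le> s" using ln_le_minus_one[OF assms] by simp
  moreover have "- ln s = 2 * ln (s powr (- (1/2)))" using assms by (simp add: ln_powr)
  moreover have "ln (s powr (- (1/2))) \<le> s powr (- (1/2))"
    using ln_le_minus_one[of "s powr (- (1/2))"] assms by simp
  moreover have "0 \<le> s powr (- (1/2))" by simp
  ultimately show ?thesis using assms by (simp only: abs_le_iff) linarith
qed

lemma ln_profile: "s > 0 \<Longrightarrow> ln (4/3 * sqrt s) = ln (4/3) + 1/2 * ln s"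
  by (subst ln_mult) (simp_all add: ln_sqrt)

lemma power_profile_Lp:
  assumes "p \<ge> 1" "\<alpha> > 0"
  shows "Lp_on_cubes p (\<lambda>x. (4/3 * sqrt (rad x)) powr \<alpha>)"
proof (rule Lp_on_cubes_if_dominated[where i = 1 and j = 2 and a = 0 and b = 0])
  fix R :: real assume "R \<ge> 0"
  show "\<exists>C. \<forall>x\<in>cube R. x $ 1 \<noteq> 0 \<longrightarrow> x $ 2 \<noteq> 0 \<longrightarrow>
      \<bar>(4/3 * sqrt (rad x)) powr \<alpha>\<bar> \<le> C * (\<bar>x $ 1\<bar> powr (- 0) * \<bar>x $ 2\<bar> powr (- 0))"
  proof (intro exI ballI impI)
    fix x assume x: "x \<in> cube R" "x $ 1 \<noteq> 0" "x $ 2 \<noteq> 0"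
    have "(4/3 * sqrt (rad x)) powr \<alpha> \<le> (4/3 * sqrt (2 * R powr (2/3))) powr \<alpha>"
      using assms rad_le_cube[OF x(1)] rad_nonneg by (intro powr_mono2) simp_all
    then show "\<bar>(4/3 * sqrt (rad x)) powr \<alpha>\<bar>
        \<le> (4/3 * sqrt (2 * R powr (2/3))) powr \<alpha> * (\<bar>x $ 1\<bar> powr (- 0) * \<bar>x $ 2\<bar> powr (- 0))"
      using x by simp
  qed
qed (use assms in \<open>simp_all, measurable\<close>)

text \<open>The singular part of the logarithm is at most \<open>\<bar>x $ 1\<bar> powr (-
  (1/3))\<close>. The bounded part is absorbed into it, since \<open>\<bar>x $ 1\<bar>\<close> is
  bounded as well.\<close>

lemma log_profile_Lp:
  assumes "1 \<le> p" "p < 3"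
  shows "Lp_on_cubes p (\<lambda>x. ln (4/3 * sqrt (rad x)))"
proof (rule Lp_on_cubes_if_dominated[where i = 1 and j = 2 and a = "1/3" and b = 0])
  fix R :: real assume "R \<ge> 0"
  let ?B = "\<bar>ln (4/3)\<bar> + R powr (2/3)"
  show "\<exists>C. \<forall>x\<in>cube R. x $ 1 \<noteq> 0 \<longrightarrow> x $ 2 \<noteq> 0 \<longrightarrow>
      \<bar>ln (4/3 * sqrt (rad x))\<bar> \<le> C * (\<bar>x $ 1\<bar> powr (- (1/3)) * \<bar>x $ 2\<bar> powr (- 0))"
  proof (intro exI ballI impI)
    fix x assume x: "x \<in> cube R" "x $ 1 \<noteq> 0" "x $ 2 \<noteq> 0"
    have pos: "rad x > 0" by (rule rad_pos[OF x(2)])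
    have "\<bar>ln (4/3 * sqrt (rad x))\<bar> = \<bar>ln (4/3) + 1/2 * ln (rad x)\<bar>"
      by (simp only: ln_profile[OF pos])
    also have "\<dots> \<le> \<bar>ln (4/3)\<bar> + 1/2 * (rad x + 2 * rad x powr (- (1/2)))"
      using abs_ln_le[OF pos] abs_triangle_ineq[of "ln (4/3)" "1/2 * ln (rad x)"]
      by (simp add: abs_mult field_simps)
    also have "\<dots> \<le> ?B + rad x powr (- (1/2))"
      using rad_le_cube[OF x(1)] by simp
    also have "rad x powr (- (1/2)) \<le> (\<bar>x $ 1\<bar> powr (2/3)) powr (- (1/2))"
      using x abs_powr_le_rad by (intro powr_mono2') simp_all
    also have "\<dots> = \<bar>x $ 1\<bar> powr (- (1/3))" by (simp add: powr_powr)
    also have "?B + \<bar>x $ 1\<bar> powr (- (1/3)) \<le> ?B * (R powr (1/3) * \<bar>x $ 1\<bar> powr (- (1/3))) + \<bar>x $ 1\<bar> powr (- (1/3))"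
    proof -
      have "\<bar>x $ 1\<bar> powr (1/3) \<le> R powr (1/3)"
        using x(1) by (intro powr_mono2) (simp_all add: cube_def)
      then have "\<bar>x $ 1\<bar> powr (1/3) * \<bar>x $ 1\<bar> powr (- (1/3)) \<le> R powr (1/3) * \<bar>x $ 1\<bar> powr (- (1/3))"
        by (rule mult_right_mono) simp
      moreover have "\<bar>x $ 1\<bar> powr (1/3) * \<bar>x $ 1\<bar> powr (- (1/3)) = 1"
        using x(2) by (simp add: powr_add[symmetric])
      ultimately have "?B * 1 \<le> ?B * (R powr (1/3) * \<bar>x $ 1\<bar> powr (- (1/3)))"
        by (intro mult_left_mono) simp_all
      then show ?thesis by simp
    qed
    also have "\<dots> = (?B * R powr (1/3) + 1) * (\<bar>x $ 1\<bar> powr (- (1/3)) * \<bar>x $ 2\<bar> powr (- 0))"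
      using x by (simp add: algebra_simps)
    finally show "\<bar>ln (4/3 * sqrt (rad x))\<bar>
        \<le> (?B * R powr (1/3) + 1) * (\<bar>x $ 1\<bar> powr (- (1/3)) * \<bar>x $ 2\<bar> powr (- 0))" by simp
  qed
qed (use assms in \<open>simp_all, measurable\<close>)

lemma power_profile_derivative:
  assumes "s > 0"
  shows "((\<lambda>s. (4/3 * sqrt s) powr \<alpha>) has_real_derivative
    3/2 * ((4/3) powr \<alpha> * \<alpha> / 3) * s powr (\<alpha> / 2 - 1)) (at s)"
proof -
  have "((\<lambda>s. (4/3) powr \<alpha> * s powr (\<alpha> / 2)) has_real_derivative
      (4/3) powr \<alpha> * (\<alpha> / 2 * s powr (\<alpha> / 2 - 1))) (at s)"
    by (intro DERIV_cmult has_real_derivative_powr assms)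
  then have "((\<lambda>s. (4/3) powr \<alpha> * s powr (\<alpha> / 2)) has_real_derivative
      3/2 * ((4/3) powr \<alpha> * \<alpha> / 3) * s powr (\<alpha> / 2 - 1)) (at s)" by (simp add: mult_ac)
  then show ?thesis
  proof (rule has_field_derivative_transform_within_open[of _ _ _ "{0<..}"])
    fix t :: real assume "t \<in> {0<..}"
    then show "(4/3) powr \<alpha> * t powr (\<alpha> / 2) = (4/3 * sqrt t) powr \<alpha>"
      by (subst powr_mult) (simp_all add: powr_half_sqrt[symmetric] powr_powr)
  qed (use assms in simp_all)
qed

lemma log_profile_derivative:
  assumes "s > 0"
  shows "((\<lambda>s. ln (4/3 * sqrt s)) has_real_derivative 3/2 * (1/3) * s powr (0 / 2 - 1)) (at s)"
proof -
  have "((\<lambda>s. ln (4/3) + 1/2 * ln s) has_real_derivative 3/2 * (1/3) * s powr (0 / 2 - 1)) (at s)"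
    using assms by (auto intro!: derivative_eq_intros simp: powr_minus field_simps)
  then show ?thesis
  proof (rule has_field_derivative_transform_within_open[of _ _ _ "{0<..}"])
    fix t :: real assume "t \<in> {0<..}"
    then show "ln (4/3) + 1/2 * ln t = ln (4/3 * sqrt t)"
      by (simp only: ln_profile greaterThan_iff)
  qed (use assms in simp_all)
qed

lemma radial_W1p_loc:
  assumes G: "\<And>s. s > 0 \<Longrightarrow> (G has_real_derivative 3/2 * C * s powr (\<alpha> / 2 - 1)) (at s)"
    and \<alpha>: "0 \<le> \<alpha>" and p: "1 \<le> p" "p < 3" "p * (3 - \<alpha>) < 6"
    and Lp: "\<And>q. 1 \<le> q \<Longrightarrow> q < 3 \<Longrightarrow> Lp_on_cubes q (\<lambda>x. G (rad x))"
  shows "(\<lambda>x. G (rad x)) \<in> W1p_loc p UNIV"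
  by (rule W1p_loc_if_slices[where g = "radial_deriv \<alpha> C"])
    (use assms in \<open>simp_all add: radial_deriv_Lp radial_slice_continuous[OF G] radial_slice_derivative[OF G]\<close>)

lemma radial_weak_deriv:
  assumes G: "\<And>s. s > 0 \<Longrightarrow> (G has_real_derivative 3/2 * C * s powr (\<alpha> / 2 - 1)) (at s)"
    and \<alpha>: "0 \<le> \<alpha>" and Lp: "Lp_on_cubes 1 (\<lambda>x. G (rad x))" and U: "U \<in> sets borel"
  shows "weak_partial_deriv U (axis i 1) (\<lambda>x. G (rad x)) (radial_deriv \<alpha> C i)"
  by (intro weak_partial_deriv_slices integrable_on_cubes_if_Lp_1 radial_deriv_Lp
      radial_slice_continuous[OF G] radial_slice_derivative[OF G] Lp U) (use \<alpha> in simp_all)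

section \<open>The critical exponents are not attained\<close>

text \<open>The squares with corners \<open>(h, h)\<close> and \<open>(2h, 2h)\<close> shrink to the
  origin. By homogeneity the derivative is of order \<open>h powr (- d)\<close> on them, with
  \<open>d = 1 - \<alpha> / 3\<close>, and the critical exponent \<open>p = 2 / d\<close> makes its
  \<open>p\<close>-th power compensate the area exactly.\<close>

lemma radial_not_W1p_loc_origin:
  assumes G: "\<And>s. s > 0 \<Longrightarrow> (G has_real_derivative 3/2 * C * s powr (\<alpha> / 2 - 1)) (at s)"
    and \<alpha>: "0 \<le> \<alpha>" "\<alpha> < 1" and C: "C > 0" and Lp: "Lp_on_cubes 1 (\<lambda>x. G (rad x))"
  shows "(\<lambda>x. G (rad x)) \<notin> W1p_loc (6 / (3 - \<alpha>)) UNIV"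
proof -
  define d where "d = 1 - \<alpha> / 3"
  define h where "h n = inverse (real (Suc n))" for n
  define a :: "nat \<Rightarrow> real ^ 2" where "a n = (\<chi> k. h n)" for n
  have h: "h n > 0" "h n \<le> 1" for n by (simp_all add: h_def field_simps)
  define p where "p = 6 / (3 - \<alpha>)"
  have p: "p \<ge> 1" "d * p = 2" using \<alpha> by (simp_all add: p_def d_def field_simps)
  define K where "K = C * 2 powr (\<alpha> / 2 - 1)"
  have K: "K > 0" using C by (simp add: K_def)
  have g: "integrable_on_cubes (radial_deriv \<alpha> C 1)"
    using \<alpha> by (intro integrable_on_cubes_if_Lp_1 radial_deriv_Lp) simp_all
  show ?thesis unfolding p_def[symmetric]
  proof (rule not_W1p_loc_if_blowup[OF p(1) g radial_weak_deriv[OF G \<alpha>(1) Lp],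
        where a = a and l = a and R = 2
          and m = "\<lambda>n. K * (2 * h n) powr (- d)" and c = "K powr p / 4"])
    fix n
    show "cbox (a n) (a n + a n) \<subseteq> cube 2"
    proof
      fix x assume x: "x \<in> cbox (a n) (a n + a n)"
      then have "h n \<le> x $ k" "x $ k \<le> h n + h n" for k by (simp_all add: mem_box_cart a_def)
      then have "\<bar>x $ k\<bar> \<le> 2" for k using h[of n] by (smt (verit))
      then show "x \<in> cube 2" by (simp add: cube_def)
    qed
    show "K * (2 * h n) powr (- d) > 0" using K h[of n] by simp
    have "(K * (2 * h n) powr (- d)) powr p = K powr p * (2 * h n) powr (- 2)"
      using K h[of n] p(2) by (simp add: powr_mult powr_powr del: mult_pos_pos)
    also have "(2 * h n) powr (- 2) = 1 / (4 * (h n * h n))"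
      using h[of n] by (simp add: powr_minus powr_numeral power2_eq_square field_simps)
    finally show "K powr p / 4 \<le> (K * (2 * h n) powr (- d)) powr p * (a n $ 1 * a n $ 2)"
      using h[of n] by (simp add: a_def)
  next
    fix n x assume "x \<in> box (a n) (a n + a n)"
    then have x: "h n < x $ k" "x $ k < 2 * h n" for k by (simp_all add: mem_box_cart a_def)
    have pos: "0 < x $ k" for k using x(1)[of k] h(1)[of n] by linarith
    have "x \<in> cube (2 * h n)" using x(2) pos by (simp add: cube_def less_imp_le abs_of_pos)
    then have "(2 * (2 * h n) powr (2/3)) powr (\<alpha> / 2 - 1) \<le> rad x powr (\<alpha> / 2 - 1)"
      using \<alpha> rad_le_cube[of x "2 * h n"] rad_pos[of x 1] pos[of 1] by (intro powr_mono2') simp_all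
    moreover have "(2 * h n) powr (- (1/3)) \<le> (x $ 1) powr (- (1/3))"
      using x(2)[of 1] pos[of 1] by (intro powr_mono2') simp_all
    ultimately have "C * (2 * (2 * h n) powr (2/3)) powr (\<alpha> / 2 - 1) * (2 * h n) powr (- (1/3))
        \<le> C * rad x powr (\<alpha> / 2 - 1) * (x $ 1) powr (- (1/3))"
      using C by (intro mult_mono mult_left_mono) simp_all
    also have "\<dots> = radial_deriv \<alpha> C 1 x" using pos[of 1] by (simp add: radial_deriv_def)
    also have "(2 * (2 * h n) powr (2/3)) powr (\<alpha> / 2 - 1)
        = 2 powr (\<alpha> / 2 - 1) * (2 * h n) powr (2/3 * (\<alpha> / 2 - 1))"
      by (subst powr_mult) (simp_all add: powr_powr)
    also have "C * (2 powr (\<alpha> / 2 - 1) * (2 * h n) powr (2/3 * (\<alpha> / 2 - 1))) * (2 * h n) powr (- (1/3))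
        = K * ((2 * h n) powr (2/3 * (\<alpha> / 2 - 1)) * (2 * h n) powr (- (1/3)))"
      by (simp only: K_def mult.assoc)
    also have "(2 * h n) powr (2/3 * (\<alpha> / 2 - 1)) * (2 * h n) powr (- (1/3)) = (2 * h n) powr (- d)"
    proof -
      have "2/3 * (\<alpha> / 2 - 1) + - (1/3) = - d" by (simp add: d_def field_simps)
      then show ?thesis by (simp only: powr_add[symmetric])
    qed
    finally show "K * (2 * h n) powr (- d) \<le> radial_deriv \<alpha> C 1 x" .
  next
    fix x :: "real ^ 2"
    have "(\<lambda>n. 2 * h n) \<longlonglongrightarrow> 2 * 0"
      unfolding h_def by (intro tendsto_mult tendsto_const LIMSEQ_inverse_real_of_nat)
    then have lim: "(\<lambda>n. 2 * h n) \<longlonglongrightarrow> 0" by simp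
    show "\<forall>\<^sub>F n in sequentially. x \<notin> box (a n) (a n + a n)"
    proof (cases "0 < x $ 1")
      case True
      from order_tendstoD(2)[OF lim True] show ?thesis
        by eventually_elim (auto simp: mem_box_cart a_def intro!: exI[of _ 1])
    next
      case False
      then have "\<not> h n < x $ 1" for n using h(1)[of n] by linarith
      then show ?thesis by (auto simp: mem_box_cart a_def intro!: always_eventually exI[of _ 1])
    qed
  qed (use h K in \<open>simp_all add: a_def\<close>)
qed

text \<open>On bounded sets away from the origin \<open>rad\<close> is bounded above and below, so
  only the singularity \<open>\<bar>x $ 1\<bar> powr (- (1/3))\<close> along the axis matters; its
  cube is not integrable. The boxes have sides \<open>h\<close> and \<open>1\<close> and collapse
  onto the axis.\<close>

lemma radial_not_W1p_loc_axis:
  assumes G: "\<And>s. s > 0 \<Longrightarrow> (G has_real_derivative 3/2 * C * s powr (\<alpha> / 2 - 1)) (at s)"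
    and \<alpha>: "1 \<le> \<alpha>" and C: "C > 0" and Lp: "Lp_on_cubes 1 (\<lambda>x. G (rad x))"
  shows "(\<lambda>x. G (rad x)) \<notin> W1p_loc 3 UNIV"
proof -
  define h where "h n = inverse (real (Suc n))" for n
  have h: "h n > 0" "h n \<le> 1" for n by (simp_all add: h_def field_simps)
  define K where "K = C * min 1 (4 powr (\<alpha> / 2 - 1))"
  have K: "K > 0" using C by (simp add: K_def)
  define a :: "nat \<Rightarrow> real ^ 2" where "a n = (\<chi> k. if k = 1 then h n else 1)" for n
  have g: "integrable_on_cubes (radial_deriv \<alpha> C 1)"
    using \<alpha> by (intro integrable_on_cubes_if_Lp_1 radial_deriv_Lp) simp_all
  have "(0::real) \<le> \<alpha>" using \<alpha> by simp
  show ?thesis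
  proof (rule not_W1p_loc_if_blowup[OF _ g radial_weak_deriv[OF G \<open>0 \<le> \<alpha>\<close> Lp],
        where a = a and l = a and R = 2 and m = "\<lambda>n. K * (2 * h n) powr (- (1/3))" and c = "K powr 3 / 2"])
    fix n
    show "cbox (a n) (a n + a n) \<subseteq> cube 2"
    proof
      fix x assume x: "x \<in> cbox (a n) (a n + a n)"
      then have "h n \<le> x $ 1" "x $ 1 \<le> h n + h n" "1 \<le> x $ 2" "x $ 2 \<le> 2"
        by (auto simp: mem_box_cart a_def dest: spec[of _ 1] spec[of _ 2])
      then have "\<bar>x $ 1\<bar> \<le> 2" "\<bar>x $ 2\<bar> \<le> 2" using h[of n] by linarith+
      then show "x \<in> cube 2" by (simp add: cube_def forall_2)
    qed
    show "K * (2 * h n) powr (- (1/3)) > 0" using K h[of n] by simp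
    have "(K * (2 * h n) powr (- (1/3))) powr 3 = K powr 3 * (2 * h n) powr (- 1)"
      using K h[of n] by (simp add: powr_mult powr_powr)
    also have "(2 * h n) powr (- 1) = 1 / (2 * h n)"
      using h[of n] by (simp add: powr_minus field_simps)
    finally show "K powr 3 / 2 \<le> (K * (2 * h n) powr (- (1/3))) powr 3 * (a n $ 1 * a n $ 2)"
      using h[of n] by (simp add: a_def)
  next
    fix n x assume "x \<in> box (a n) (a n + a n)"
    then have x: "h n < x $ 1" "x $ 1 < 2 * h n" "1 < x $ 2" "x $ 2 < 2"
      by (auto simp: mem_box_cart a_def dest: spec[of _ 1] spec[of _ 2])
    have pos: "0 < x $ 1" using x(1) h(1)[of n] by linarith
    have "\<bar>x $ 1\<bar> powr (2/3) \<le> 2 powr 1" "\<bar>x $ 2\<bar> powr (2/3) \<le> 2 powr 1"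
      using powr_mono2[of "2/3" "\<bar>x $ 1\<bar>" 2] powr_mono2[of "2/3" "\<bar>x $ 2\<bar>" 2] powr_mono[of "2/3" 1 "2::real"]
        x h[of n] pos by (simp_all del: powr_one)
    then have le: "rad x \<le> 4" by (simp add: rad_def)
    have "1 powr (2/3) \<le> \<bar>x $ 2\<bar> powr (2/3)" using x by (intro powr_mono2) simp_all
    then have ge: "1 \<le> rad x" using abs_powr_le_rad[of x 2] by simp
    have "min 1 (4 powr (\<alpha> / 2 - 1)) \<le> rad x powr (\<alpha> / 2 - 1)"
    proof (cases "\<alpha> \<ge> 2")
      case True
      then have "1 powr (\<alpha> / 2 - 1) \<le> rad x powr (\<alpha> / 2 - 1)" using ge by (intro powr_mono2) simp_all
      then show ?thesis by simp
    next
      case False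
      then have "4 powr (\<alpha> / 2 - 1) \<le> rad x powr (\<alpha> / 2 - 1)" using le ge by (intro powr_mono2') simp_all
      then show ?thesis by simp
    qed
    moreover have "(2 * h n) powr (- (1/3)) \<le> (x $ 1) powr (- (1/3))"
      using x(2) pos by (intro powr_mono2') simp_all
    ultimately have "K * (2 * h n) powr (- (1/3)) \<le> C * rad x powr (\<alpha> / 2 - 1) * (x $ 1) powr (- (1/3))"
      unfolding K_def using C by (intro mult_mono mult_left_mono) simp_all
    also have "\<dots> = radial_deriv \<alpha> C 1 x" using pos by (simp add: radial_deriv_def)
    finally show "K * (2 * h n) powr (- (1/3)) \<le> radial_deriv \<alpha> C 1 x" .
  next
    fix x :: "real ^ 2"
    have "(\<lambda>n. 2 * h n) \<longlonglongrightarrow> 2 * 0"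
      unfolding h_def by (intro tendsto_mult tendsto_const LIMSEQ_inverse_real_of_nat)
    then have lim: "(\<lambda>n. 2 * h n) \<longlonglongrightarrow> 0" by simp
    show "\<forall>\<^sub>F n in sequentially. x \<notin> box (a n) (a n + a n)"
    proof (cases "0 < x $ 1")
      case True
      from order_tendstoD(2)[OF lim True] show ?thesis
        by eventually_elim (auto simp: mem_box_cart a_def intro!: exI[of _ 1])
    next
      case False
      then have "\<not> h n < x $ 1" for n using h(1)[of n] by linarith
      then show ?thesis by (auto simp: mem_box_cart a_def intro!: always_eventually exI[of _ 1])
    qed
  qed (use h K in \<open>simp_all add: a_def\<close>)
qed

section \<open>Bounded mean oscillation of the logarithm\<close>

text \<open>The average of \<open>f\<close> differs from any constant \<open>c\<close> by at most
  the mean of \<open>\<bar>f - c\<bar>\<close>, so replacing \<open>c\<close> by the average at most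
  doubles that mean.\<close>

lemma ball_average_oscillation:
  fixes f :: "real ^ 2 \<Rightarrow> real"
  assumes f: "integrable (lebesgue_on (cball x r)) f" and r: "r > 0"
    and K: "(\<integral>y. \<bar>f y - c\<bar> \<partial>lebesgue_on (cball x r)) \<le> K * measure lebesgue (cball x r)"
  shows "ball_average (\<lambda>y. \<bar>f y - ball_average f x r\<bar>) x r \<le> 2 * K"
proof -
  let ?M = "lebesgue_on (cball x r)" and ?\<mu> = "measure lebesgue (cball x r)"
  have mu: "?\<mu> > 0"
    using r content_cball_pos[of r x] by simp
  interpret finite_measure ?M by (rule finite_measure_lebesgue_on) simp
  have space: "measure ?M (cball x r) = measure lborel (cball x r)" by (simp add: measure_restrict_space)
  define A where "A = ball_average f x r"
  have "A * ?\<mu> = (\<integral>y. f y \<partial>?M)" using mu by (simp add: A_def ball_average_def)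
  then have "(A - c) * ?\<mu> = (\<integral>y. f y - c \<partial>?M)" using f by (simp add: space algebra_simps)
  then have "\<bar>A - c\<bar> * ?\<mu> = \<bar>\<integral>y. f y - c \<partial>?M\<bar>" using mu by (metis abs_mult abs_of_pos)
  also have "\<dots> \<le> (\<integral>y. \<bar>f y - c\<bar> \<partial>?M)" by (rule integral_abs_bound)
  finally have A: "\<bar>A - c\<bar> * ?\<mu> \<le> K * ?\<mu>" using K by linarith
  have "(\<integral>y. \<bar>f y - A\<bar> \<partial>?M) \<le> (\<integral>y. \<bar>f y - c\<bar> + \<bar>A - c\<bar> \<partial>?M)"
    using f by (intro integral_mono) auto
  also have "\<dots> = (\<integral>y. \<bar>f y - c\<bar> \<partial>?M) + \<bar>A - c\<bar> * ?\<mu>" using f by (simp add: space)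
  finally have "(\<integral>y. \<bar>f y - A\<bar> \<partial>?M) \<le> 2 * K * ?\<mu>" using A K by simp
  then show ?thesis unfolding A_def[symmetric] using mu by (subst ball_average_def) (simp only: pos_divide_le_eq)
qed

text \<open>On a ball whose distance from the origin exceeds its size, \<open>rad\<close> varies by
  a bounded factor only.\<close>

lemma log_profile_oscillation_far:
  assumes r: "r > 0" and i: "2 * r \<le> \<bar>x $ i\<bar>" "\<And>k. \<bar>x $ k\<bar> \<le> \<bar>x $ i\<bar>"
    and y: "y \<in> cball x r"
  shows "\<bar>ln (4/3 * sqrt (rad y)) - (ln (4/3) + 1/3 * ln \<bar>x $ i\<bar>)\<bar> \<le> 2"
proof -
  define N where "N = \<bar>x $ i\<bar>"
  have N: "N > 0" "2 * r \<le> N" using i r by (simp_all add: N_def)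
  have diff: "\<bar>x $ k - y $ k\<bar> \<le> r" for k
    using component_le_norm_cart[of "x - y" k] y by (simp add: dist_norm)
  have "\<bar>y $ k\<bar> \<le> 2 * N" for k using diff[of k] i(2)[of k] N by (simp add: N_def)
  then have "rad y \<le> 2 * (2 * N) powr (2/3)" by (intro rad_le_cube) (simp add: cube_def)
  also have "\<dots> \<le> 4 * N powr (2/3)"
    using N powr_mono[of "2/3" 1 "2::real"] by (simp add: powr_mult)
  finally have upper: "rad y \<le> 4 * N powr (2/3)" .
  have "N / 2 \<le> \<bar>y $ i\<bar>" using diff[of i] N by (simp add: N_def)
  then have "(N / 2) powr (2/3) \<le> \<bar>y $ i\<bar> powr (2/3)" using N by (intro powr_mono2) simp_all
  then have "(N / 2) powr (2/3) \<le> rad y" using abs_powr_le_rad[of y i] by simp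
  moreover have "N powr (2/3) / 2 \<le> (N / 2) powr (2/3)"
    using N powr_mono[of "2/3" 1 "2::real"] unfolding powr_divide
    by (intro divide_left_mono) simp_all
  ultimately have lower: "N powr (2/3) / 4 \<le> rad y" using powr_ge_zero[of N "2/3"] by linarith
  have pos: "rad y > 0" using lower N powr_gt_zero[of N "2/3"] by linarith
  have ln_N: "ln (N powr (2/3)) = 2/3 * ln N" using N by (simp add: ln_powr)
  have "ln (rad y) \<le> ln (4 * N powr (2/3))" using upper pos N by (subst ln_le_cancel_iff) simp_all
  also have "\<dots> = ln 4 + 2/3 * ln N" using N ln_N by (simp add: ln_mult)
  finally have u: "ln (rad y) \<le> ln 4 + 2/3 * ln N" .
  have "ln (N powr (2/3) / 4) \<le> ln (rad y)" using lower pos N by (subst ln_le_cancel_iff) simp_all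
  moreover have "ln (N powr (2/3) / 4) = 2/3 * ln N - ln 4" using N ln_N by (simp add: ln_div)
  ultimately have l: "2/3 * ln N - ln 4 \<le> ln (rad y)" by simp
  have "ln (4::real) \<le> 3" using ln_le_minus_one[of "4::real"] by simp
  with u l show ?thesis
    unfolding ln_profile[OF pos] N_def[symmetric] abs_le_iff by (simp add: field_simps)
qed

text \<open>Both sides depend on \<open>y / r\<close> alone, so the mean of the right side over a
  square of size comparable to \<open>r\<close> does not depend on \<open>r\<close>.\<close>

lemma log_profile_oscillation_near:
  assumes r: "r > 0" and y: "y \<in> cube (3 * r)" "y $ 1 \<noteq> 0"
  shows "\<bar>ln (4/3 * sqrt (rad y)) - (ln (4/3) + 1/3 * ln r)\<bar>
           \<le> 3 + r powr (1/3) * \<bar>y $ 1\<bar> powr (- (1/3))"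
proof -
  have pos: "rad y > 0" by (rule rad_pos[OF y(2)])
  define s where "s = rad y / r powr (2/3)"
  have s: "s > 0" using pos r by (simp add: s_def)
  have "ln s = ln (rad y) - 2/3 * ln r"
    using pos r by (simp add: s_def ln_div ln_powr)
  then have "\<bar>ln (4/3 * sqrt (rad y)) - (ln (4/3) + 1/3 * ln r)\<bar> = 1/2 * \<bar>ln s\<bar>"
    unfolding ln_profile[OF pos] by (simp add: field_simps abs_if)
  also have "\<dots> \<le> 1/2 * (s + 2 * s powr (- (1/2)))" using abs_ln_le[OF s] by simp
  also have "\<dots> = s / 2 + s powr (- (1/2))" by simp
  also have "\<dots> \<le> 3 + r powr (1/3) * \<bar>y $ 1\<bar> powr (- (1/3))"
  proof (rule add_mono)
    have "rad y \<le> 2 * (3 * r) powr (2/3)" by (rule rad_le_cube[OF y(1)])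
    also have "\<dots> \<le> 6 * r powr (2/3)"
      using r powr_mono[of "2/3" 1 "3::real"] by (simp add: powr_mult)
    finally show "s / 2 \<le> 3" using r by (simp add: s_def divide_le_eq)
    have "s powr (- (1/2)) = rad y powr (- (1/2)) / (r powr (2/3)) powr (- (1/2))"
      unfolding s_def by (rule powr_divide)
    also have "\<dots> = r powr (1/3) * rad y powr (- (1/2))"
      using r by (simp add: powr_powr powr_minus field_simps)
    also have "rad y powr (- (1/2)) \<le> (\<bar>y $ 1\<bar> powr (2/3)) powr (- (1/2))"
      using y abs_powr_le_rad by (intro powr_mono2') simp_all
    also have "\<dots> = \<bar>y $ 1\<bar> powr (- (1/3))" by (simp add: powr_powr)
    finally show "s powr (- (1/2)) \<le> r powr (1/3) * \<bar>y $ 1\<bar> powr (- (1/3))"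
      using r by (simp add: mult_left_mono)
  qed
  finally show ?thesis .
qed

text \<open>In the near case the bound \<open>3\<close> contributes three times the area
  \<open>\<mu>\<close> of the ball and the singular term at most \<open>54 * r\<^sup>2 \<le> 18 *
  \<mu>\<close>.\<close>

lemma log_profile_mean_oscillation:
  assumes r: "r > 0"
  shows "\<exists>c. (\<integral>y. \<bar>ln (4/3 * sqrt (rad y)) - c\<bar> \<partial>lebesgue_on (cball x r))
           \<le> 21 * measure lebesgue (cball x r)"
proof -
  let ?f = "\<lambda>y. ln (4/3 * sqrt (rad y))" and ?B = "cball x r"
  let ?\<mu> = "measure lebesgue ?B"
  have Bm: "?B \<in> sets borel" by simp
  have "emeasure lborel ?B < \<infinity>" by (rule emeasure_bounded_finite) simp
  then have intB: "integrable lborel (indicator ?B :: _ \<Rightarrow> real)"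
    by (intro integrable_real_indicator) simp_all
  have muB: "(\<integral>y. indicator ?B y \<partial>lborel) = ?\<mu>" by simp
  have eq: "(\<integral>y. \<bar>?f y - c\<bar> \<partial>lebesgue_on ?B) = (\<integral>y. indicator ?B y * \<bar>?f y - c\<bar> \<partial>lborel)" for c
    by (rule integral_lebesgue_on_borel[OF Bm]) measurable
  \<comment> \<open>The area of the disc is pi times the square of the radius.\<close>
  have mu: "3 * r\<^sup>2 \<le> ?\<mu>"
    using r content_cball[of r x] pi_gt3 by (simp add: unit_ball_vol_2)
  obtain i where i: "\<And>k. \<bar>x $ k\<bar> \<le> \<bar>x $ i\<bar>"
    by (metis (full_types) exhaust_2 linear order_refl)
  show ?thesis
  proof (cases "2 * r \<le> \<bar>x $ i\<bar>")
    case True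
    let ?c = "ln (4/3) + 1/3 * ln \<bar>x $ i\<bar>"
    have "(\<integral>y. indicator ?B y * \<bar>?f y - ?c\<bar> \<partial>lborel) \<le> (\<integral>y. 2 * indicator ?B y \<partial>lborel)"
    proof (rule integral_mono')
      fix y show "indicator ?B y * \<bar>?f y - ?c\<bar> \<le> 2 * indicator ?B y"
        using log_profile_oscillation_far[OF r True i, of y] by (cases "y \<in> ?B") simp_all
    qed (use intB in simp_all)
    also have "\<dots> = 2 * ?\<mu>" using muB by simp
    also have "\<dots> \<le> 21 * ?\<mu>" by simp
    finally show ?thesis unfolding eq by blast
  next
    case False
    let ?c = "ln (4/3) + 1/3 * ln r"
    have sub: "?B \<subseteq> cube (3 * r)"
    proof
      fix y assume "y \<in> ?B"
      then have "\<bar>x $ k - y $ k\<bar> \<le> r" for k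
        using component_le_norm_cart[of "x - y" k] by (simp add: dist_norm)
      then have "\<bar>y $ k\<bar> \<le> 3 * r" for k using i[of k] False by (smt (verit))
      then show "y \<in> cube (3 * r)" by (simp add: cube_def)
    qed
    let ?q = "\<lambda>y::real^2. indicator (cube (3 * r)) y * (\<bar>y $ 1\<bar> powr (- (1/3)) * \<bar>y $ 2\<bar> powr (- 0))"
    let ?I = "2 * (3 * r) powr (1 - 1/3) / (1 - 1/3) * (2 * (3 * r) powr (1 - 0) / (1 - 0))"
    have q: "has_bochner_integral lborel ?q ?I"
      using r by (intro has_bochner_integral_abs_powr_cube) simp_all
    have int: "integrable lborel (\<lambda>y. 3 * indicator ?B y + r powr (1/3) * ?q y)"
      using q intB by (intro Bochner_Integration.integrable_add integrable_mult_right)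
        (simp_all add: has_bochner_integral_iff)
    have "(\<integral>y. indicator ?B y * \<bar>?f y - ?c\<bar> \<partial>lborel)
        \<le> (\<integral>y. 3 * indicator ?B y + r powr (1/3) * ?q y \<partial>lborel)"
    proof (rule integral_mono_AE'[OF int])
      show "AE y in lborel. indicator ?B y * \<bar>?f y - ?c\<bar> \<le> 3 * indicator ?B y + r powr (1/3) * ?q y"
        using AE_lborel_nth_neq_0[of 1] AE_lborel_nth_neq_0[of 2]
      proof eventually_elim
        case (elim y)
        then show ?case using log_profile_oscillation_near[OF r, of y] sub by (cases "y \<in> ?B") auto
      qed
    qed simp
    also have "\<dots> = 3 * ?\<mu> + r powr (1/3) * ?I"
      using q intB muB by (simp add: has_bochner_integral_iff)
    also have "r powr (1/3) * ?I \<le> 54 * r\<^sup>2"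
    proof -
      have "r powr (1/3) * ?I = 18 * (3 powr (2/3) * (r powr (1/3) * r powr (2/3)) * r)"
        using r by (simp add: powr_mult)
      also have "r powr (1/3) * r powr (2/3) = r" using r by (simp add: powr_add[symmetric])
      also have "3 powr (2/3) * r * r \<le> 3 * r * r"
        using r powr_mono[of "2/3" 1 "3::real"] by (intro mult_right_mono) simp_all
      finally show ?thesis by (simp add: power2_eq_square)
    qed
    finally show ?thesis unfolding eq using mu by (intro exI[of _ ?c]) linarith
  qed
qed

lemma log_profile_BMO_loc: "(\<lambda>x. ln (4/3 * sqrt (rad x))) \<in> BMO_loc UNIV"
proof -
  let ?f = "\<lambda>x. ln (4/3 * sqrt (rad x))"
  have loc: "locally_integrable U ?f" for U
    by (intro locally_integrable_if_cubes integrable_on_cubes_if_Lp_1 log_profile_Lp) simp_all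
  have "ball_average (\<lambda>y. \<bar>?f y - ball_average ?f x r\<bar>) x r \<le> 2 * 21" if r: "r > 0" for x r
  proof -
    have "integrable (lebesgue_on (cball x r)) ?f"
      using loc[of UNIV] by (simp add: locally_integrable_def)
    moreover obtain c where "(\<integral>y. \<bar>?f y - c\<bar> \<partial>lebesgue_on (cball x r)) \<le> 21 * measure lebesgue (cball x r)"
      using log_profile_mean_oscillation[OF r, of x] by blast
    ultimately show ?thesis by (intro ball_average_oscillation r)
  qed
  then show ?thesis using loc unfolding BMO_loc_def BMO_def by blast
qed

section \<open>The regularity of powers and of the logarithm of the gradient\<close>

theorem lemma1p2:
  shows "(\<forall>\<alpha>>0. (\<forall>p\<ge>1. p < p_crit \<alpha> \<longrightarrow> (\<lambda>x. norm (grad w x) powr \<alpha>) \<in> W1p_loc p UNIV)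
            \<and> (\<lambda>x. norm (grad w x) powr \<alpha>) \<notin> W1p_loc (p_crit \<alpha>) UNIV)
       \<and> (\<forall>p\<ge>1. p < 2 \<longrightarrow> (\<lambda>x. ln (norm (grad w x))) \<in> W1p_loc p UNIV \<inter> BMO_loc UNIV)
       \<and> (\<lambda>x. ln (norm (grad w x))) \<notin> W1p_loc 2 UNIV"
  unfolding norm_grad_w
proof (intro conjI allI impI IntI)
  fix \<alpha> p :: real
  assume \<alpha>: "\<alpha> > 0" and p: "1 \<le> p" "p < p_crit \<alpha>"
  have "p < 3 \<and> p * (3 - \<alpha>) < 6"
  proof (cases "\<alpha> \<ge> 1")
    case True
    then have "p < 3" using p by (simp add: p_crit_def)
    moreover have "p * (3 - \<alpha>) \<le> p * 2" using True p by (intro mult_left_mono) simp_all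
    ultimately show ?thesis by simp
  next
    case False
    then have "p * (3 - \<alpha>) < 6" using p by (simp add: p_crit_def field_simps)
    moreover have "p * 2 \<le> p * (3 - \<alpha>)" using False p by (intro mult_left_mono) simp_all
    ultimately show ?thesis by simp
  qed
  then show "(\<lambda>x. (4/3 * sqrt (rad x)) powr \<alpha>) \<in> W1p_loc p UNIV"
    using \<alpha> p(1) power_profile_Lp[OF _ \<alpha>]
    by (intro radial_W1p_loc[OF power_profile_derivative]) simp_all
next
  fix \<alpha> :: real assume \<alpha>: "\<alpha> > 0"
  then have C: "(4/3) powr \<alpha> * \<alpha> / 3 > 0" by simp
  note Lp = power_profile_Lp[OF order_refl \<alpha>]
  show "(\<lambda>x. (4/3 * sqrt (rad x)) powr \<alpha>) \<notin> W1p_loc (p_crit \<alpha>) UNIV"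
  proof (cases "\<alpha> \<ge> 1")
    case True
    then show ?thesis
      using radial_not_W1p_loc_axis[OF power_profile_derivative True C Lp] by (simp add: p_crit_def)
  next
    case False
    then show ?thesis
      using radial_not_W1p_loc_origin[OF power_profile_derivative _ _ C Lp] \<alpha> by (simp add: p_crit_def)
  qed
next
  fix p :: real assume "1 \<le> p" "p < 2"
  then show "(\<lambda>x. ln (4/3 * sqrt (rad x))) \<in> W1p_loc p UNIV"
    using log_profile_Lp by (intro radial_W1p_loc[OF log_profile_derivative]) simp_all
next
  show "(\<lambda>x. ln (4/3 * sqrt (rad x))) \<in> BMO_loc UNIV" by (rule log_profile_BMO_loc)
next
  have "Lp_on_cubes 1 (\<lambda>x. ln (4/3 * sqrt (rad x)))" by (rule log_profile_Lp) simp_all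
  from radial_not_W1p_loc_origin[OF log_profile_derivative _ _ _ this]
  show "(\<lambda>x. ln (4/3 * sqrt (rad x))) \<notin> W1p_loc 2 UNIV" by simp
qed

end
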